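(* Let $G$ be a profinite group of type (F) and let $\Lambda \subseteq \mathrm{End}_o(G)$. (i) The group $O_\Lambda(G)$ is pronilpotent. (ii) Suppose that the set $\{\lambda(G) \mid \lambda \in \Lambda\}$ forms a base of neighbourhoods of the identity in $G$. Then $G = O_\Lambda(G)$, so $G$ is pronilpotent.
   Context: All homomorphisms between profinite groups are understood to be continuous. A profinite group $G$ is of type (F) if for every positive integer $n$ it has only finitely many open subgroups of index $n$. $\mathrm{End}_o(G)$ denotes the set of injective (continuous) endomorphisms of $G$ whose image is open in $G$. For an endomorphism $\lambda$ of $G$, $\mathrm{Con}(\lambda) = \{x \in G \mid \lim_{n\to+\infty} \lambda^n(x) = 1\}$. For $\Lambda \subseteq \mathrm{End}_o(G)$, $O_\Lambda(G) = \overline{\langle \mathrm{Con}(\lambda) \mid \lambda \in \Lambda\rangle}$, the closed subgroup of $G$ topologically generated by all the $\mathrm{Con}(\lambda)$. *)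

theory Defs
  imports "HOL-Analysis.Analysis" "HOL-Algebra.Solvable_Groups"
begin

text \<open>
  A topological group is a group \<open>G\<close> of HOL-Algebra together with an abstract topology \<open>T\<close> whose
  underlying set is \<open>carrier G\<close>. Maps are total HOL functions of which only the
  restriction to \<open>carrier G\<close> is ever used.
\<close>

definition topological_group :: "('a, 'b) monoid_scheme \<Rightarrow> 'a topology \<Rightarrow> bool" where
  "topological_group G T \<longleftrightarrow>
     group G \<and> topspace T = carrier G \<and>
     continuous_map (prod_topology T T) T (\<lambda>(x, y). x \<otimes>\<^bsub>G\<^esub> y) \<and>
     continuous_map T T (\<lambda>x. inv\<^bsub>G\<^esub> x)"

definition totally_disconnected_space :: "'a topology \<Rightarrow> bool" where
  "totally_disconnected_space T \<longleftrightarrow>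
     (\<forall>x \<in> topspace T. connected_component_of_set T x = {x})"

definition profinite_group :: "('a, 'b) monoid_scheme \<Rightarrow> 'a topology \<Rightarrow> bool" where
  "profinite_group G T \<longleftrightarrow>
     topological_group G T \<and> compact_space T \<and> Hausdorff_space T \<and> totally_disconnected_space T"

text \<open>
  An infinite index is recorded as \<open>card (rcosets H) = 0\<close>, which the
  condition \<open>n > 0\<close> excludes.
\<close>

definition type_F :: "('a, 'b) monoid_scheme \<Rightarrow> 'a topology \<Rightarrow> bool" where
  "type_F G T \<longleftrightarrow>
     (\<forall>n > 0. finite {H. subgroup H G \<and> openin T H \<and> card (rcosets\<^bsub>G\<^esub> H) = n})"

definition End_o :: "('a, 'b) monoid_scheme \<Rightarrow> 'a topology \<Rightarrow> ('a \<Rightarrow> 'a) set" where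
  "End_o G T =
     {f \<in> hom G G. continuous_map T T f \<and> inj_on f (carrier G) \<and> openin T (f ` carrier G)}"

definition Con :: "('a, 'b) monoid_scheme \<Rightarrow> 'a topology \<Rightarrow> ('a \<Rightarrow> 'a) \<Rightarrow> 'a set" where
  "Con G T f = {x \<in> carrier G. limitin T (\<lambda>n. (f ^^ n) x) \<one>\<^bsub>G\<^esub> sequentially}"

definition O_subgroup ::
    "('a, 'b) monoid_scheme \<Rightarrow> 'a topology \<Rightarrow> ('a \<Rightarrow> 'a) set \<Rightarrow> 'a set" where
  "O_subgroup G T \<Lambda> = T closure_of (generate G (\<Union>f \<in> \<Lambda>. Con G T f))"

text \<open>The numbering of the lower central series starts with the whole group at 0.\<close>

primrec lower_central_series :: "('a, 'b) monoid_scheme \<Rightarrow> nat \<Rightarrow> 'a set" where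
  "lower_central_series G 0 = carrier G"
| "lower_central_series G (Suc n) =
     generate G {x \<otimes>\<^bsub>G\<^esub> y \<otimes>\<^bsub>G\<^esub> inv\<^bsub>G\<^esub> x \<otimes>\<^bsub>G\<^esub> inv\<^bsub>G\<^esub> y | x y.
                   x \<in> lower_central_series G n \<and> y \<in> carrier G}"

definition nilpotent_group :: "('a, 'b) monoid_scheme \<Rightarrow> bool" where
  "nilpotent_group G \<longleftrightarrow> group G \<and> (\<exists>n. lower_central_series G n = {\<one>\<^bsub>G\<^esub>})"

text \<open>
  Pronilpotent: a profinite group all of whose finite continuous quotients, that is, quotients
  by open normal subgroups, are nilpotent.
\<close>

definition pronilpotent_group :: "('a, 'b) monoid_scheme \<Rightarrow> 'a topology \<Rightarrow> bool" where
  "pronilpotent_group G T \<longleftrightarrow>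
     profinite_group G T \<and> (\<forall>N. N \<lhd> G \<and> openin T N \<longrightarrow> nilpotent_group (G Mod N))"

end

theory Submission
  imports Defs
begin

text \<open>
  Let \<open>N k\<close> be the intersection of the open subgroups of index at most \<open>k\<close>. By type (F) it is open,
  and every \<open>f \<in> End_o\<close> maps it into itself. The heart of the matter is that an element \<open>x\<close> with
  \<open>f\<^sup>n(x) \<longrightarrow> 1\<close> centralises every chief factor of \<open>G\<close>. Put \<open>H = f(G)\<close>. Comparing chief lengths
  of \<open>G\<close> and of \<open>H \<cong> G\<close> shows that all chief factors of \<open>G\<close> below some \<open>N j\<close> stay irreducible
  under \<open>H\<close>. Hence the image under \<open>f\<close> of such a factor \<open>A / B\<close> is \<open>H\<close>-isomorphic to another such
  factor \<open>A' / B'\<close> of the same order \<open>k\<close>, and \<open>x\<close> centralises \<open>A / B\<close> as soon as \<open>f(x)\<close>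
  centralises \<open>A' / B'\<close>. Since \<open>N k\<close> centralises all chief factors of order at most \<open>k\<close> and some
  \<open>f\<^sup>n(x)\<close> lies in \<open>N k\<close>, iterating proves the claim below \<open>N j\<close>; above \<open>N j\<close> it is trivial for
  iterates \<open>f\<^sup>n(x) \<in> N j\<close>, and it descends from \<open>f\<^sup>n(x)\<close> to \<open>x\<close> by the Jordan-Hoelder argument.
  Thus \<open>O\<^sub>\<Lambda>(G)\<close> lies in the closed subgroup centralising all chief factors, whence pronilpotency.

  For the second part, on the finite group \<open>G / N i\<close> the images of the powers of \<open>f\<close> stabilise, which
  splits \<open>g \<in> G\<close> into an element killed by a power of \<open>f\<close> modulo \<open>N i\<close> and an element of \<open>f(G)\<close>;
  compactness yields an element of \<open>Con f\<close> in \<open>g f(G)\<close>.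
\<close>

section \<open>Invariant subgroups and chief factors\<close>

text \<open>For a subgroup \<open>H\<close> these are its normal subgroups. Conjugation in
  \<open>G\<close> is used so that the normal subgroups of \<open>G\<close> and of
  \<open>f(G)\<close> can be compared within one group structure.\<close>

definition invariant_subgroups :: "('a, 'b) monoid_scheme \<Rightarrow> 'a set \<Rightarrow> 'a set set" where
  "invariant_subgroups G H =
     {X. subgroup X G \<and> X \<subseteq> H \<and> (\<forall>h \<in> H. \<forall>x \<in> X. h \<otimes>\<^bsub>G\<^esub> x \<otimes>\<^bsub>G\<^esub> inv\<^bsub>G\<^esub> h \<in> X)}"

definition chief_factor :: "('a, 'b) monoid_scheme \<Rightarrow> 'a set \<Rightarrow> 'a set \<Rightarrow> 'a set \<Rightarrow> bool" where
  "chief_factor G H A B \<longleftrightarrow> A \<in> invariant_subgroups G H \<and> B \<in> invariant_subgroups G H \<and> B \<subset> A \<and>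
     (\<forall>X \<in> invariant_subgroups G H. B \<subseteq> X \<and> X \<subseteq> A \<longrightarrow> X = B \<or> X = A)"

text \<open>Trivial conjugation action of \<open>g\<close> on the section \<open>A / B\<close>. With
  \<open>A = {a}\<close> and \<open>B\<close> normal it says that \<open>g\<close> stabilises the
  coset \<open>a B\<close>.\<close>

definition centralises :: "('a, 'b) monoid_scheme \<Rightarrow> 'a \<Rightarrow> 'a set \<Rightarrow> 'a set \<Rightarrow> bool" where
  "centralises G g A B \<longleftrightarrow> (\<forall>a \<in> A. g \<otimes>\<^bsub>G\<^esub> a \<otimes>\<^bsub>G\<^esub> inv\<^bsub>G\<^esub> g \<otimes>\<^bsub>G\<^esub> inv\<^bsub>G\<^esub> a \<in> B)"

text \<open>A stand-in for \<open>|A : B| \<le> k\<close>. Representatives may lie outside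
  \<open>A\<close>, so the bound survives shrinking \<open>A\<close> and enlarging
  \<open>B\<close>.\<close>

definition covered_by_cosets :: "('a, 'b) monoid_scheme \<Rightarrow> 'a set \<Rightarrow> 'a set \<Rightarrow> nat \<Rightarrow> bool" where
  "covered_by_cosets G A B k \<longleftrightarrow>
     (\<exists>F. finite F \<and> card F \<le> k \<and> F \<subseteq> carrier G \<and> A \<subseteq> (\<Union>f \<in> F. f <#\<^bsub>G\<^esub> B))"

context group
begin

lemma inv_cancel_left:
  assumes "x \<in> carrier G" "y \<in> carrier G"
  shows "x \<otimes> (inv x \<otimes> y) = y" "inv x \<otimes> (x \<otimes> y) = y"
  using assms by (simp_all add: m_assoc[symmetric])

lemma set_multI: "x \<in> X \<Longrightarrow> y \<in> Y \<Longrightarrow> x \<otimes> y \<in> X <#> Y"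
  by (auto simp: set_mult_def)

section \<open>Products and intersections of invariant subgroups\<close>

lemma invariant_subgroupsD:
  assumes "X \<in> invariant_subgroups G H"
  shows "subgroup X G" "X \<subseteq> H" "X \<subseteq> carrier G" "\<one> \<in> X"
    and "\<And>x y. x \<in> X \<Longrightarrow> y \<in> X \<Longrightarrow> x \<otimes> y \<in> X"
    and "\<And>x. x \<in> X \<Longrightarrow> inv x \<in> X"
    and "\<And>h x. h \<in> H \<Longrightarrow> x \<in> X \<Longrightarrow> h \<otimes> x \<otimes> inv h \<in> X"
  using assms
  by (auto simp: invariant_subgroups_def subgroup.one_closed subgroup.m_closed
      subgroup.m_inv_closed dest: subgroup.subset)

lemma invariant_conj_inv:
  assumes "subgroup H G" "X \<in> invariant_subgroups G H" "h \<in> H" "x \<in> X"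
  shows "inv h \<otimes> x \<otimes> h \<in> X"
proof -
  have "inv h \<in> H" "h \<in> carrier G"
    using assms by (auto simp: subgroup.m_inv_closed dest: subgroup.mem_carrier)
  then show ?thesis
    using invariant_subgroupsD(7)[OF assms(2), of "inv h" x] assms(4) by simp
qed

lemma invariant_Int:
  assumes "X \<in> invariant_subgroups G H" "Y \<in> invariant_subgroups G K" "K \<subseteq> H"
  shows "X \<inter> Y \<in> invariant_subgroups G K"
proof -
  have "subgroup (X \<inter> Y) G"
    using assms invariant_subgroupsD(1) subgroups_Inter_pair by blast
  then show ?thesis
    using assms unfolding invariant_subgroups_def by blast
qed

lemma invariant_mono:
  assumes "X \<in> invariant_subgroups G H" "K \<subseteq> H" "X \<subseteq> K"
  shows "X \<in> invariant_subgroups G K"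
  using assms unfolding invariant_subgroups_def by blast

lemma set_mult_least:
  assumes "subgroup Z G" "X \<subseteq> Z" "Y \<subseteq> Z"
  shows "X <#> Y \<subseteq> Z"
  proof
  fix z assume "z \<in> X <#> Y"
  then obtain x y where "x \<in> X" "y \<in> Y" "z = x \<otimes> y" by (auto simp: set_mult_def)
  then show "z \<in> Z" using assms subgroup.m_closed[OF assms(1), of x y] by auto
qed

lemma subgroup_set_mult:
  assumes "subgroup H G" "subgroup X G" "X \<subseteq> H" "Y \<in> invariant_subgroups G H"
  shows "subgroup (X <#> Y) G"
proof -
  have "X \<in> invariant_subgroups G X"
    using assms(2)
    by (auto simp: invariant_subgroups_def subgroup.m_closed subgroup.m_inv_closed)
  note X = invariant_subgroupsD[OF this] and Y = invariant_subgroupsD[OF assms(4)]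
  have xc: "x \<in> carrier G" if "x \<in> X" for x using X(3) that by auto
  have yc: "x \<in> carrier G" if "x \<in> Y" for x using Y(3) that by auto
  show ?thesis
  proof (rule subgroupI)
    show "X <#> Y \<subseteq> carrier G" using X(3) Y(3) by (auto simp: set_mult_def)
    show "X <#> Y \<noteq> {}" using X(4) Y(4) by (auto simp: set_mult_def)
  next
    fix z assume "z \<in> X <#> Y"
    then obtain x y where z: "x \<in> X" "y \<in> Y" "z = x \<otimes> y" by (auto simp: set_mult_def)
    have "inv z = inv x \<otimes> (x \<otimes> inv y \<otimes> inv x)"
      using z xc yc by (simp add: inv_mult_group m_assoc[symmetric])
    moreover have "x \<otimes> inv y \<otimes> inv x \<in> Y"
      using z assms(3) Y(6,7) by blast
    ultimately show "inv z \<in> X <#> Y" using set_multI[OF X(6)[OF z(1)]] by simp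
  next
    fix z z' assume "z \<in> X <#> Y" "z' \<in> X <#> Y"
    then obtain x y x' y' where z: "x \<in> X" "y \<in> Y" "z = x \<otimes> y" "x' \<in> X" "y' \<in> Y" "z' = x' \<otimes> y'"
      by (auto simp: set_mult_def)
    have "z \<otimes> z' = (x \<otimes> x') \<otimes> ((inv x' \<otimes> y \<otimes> x') \<otimes> y')"
      using z xc yc by (simp add: m_assoc inv_cancel_left)
    moreover have "inv x' \<otimes> y \<otimes> x' \<in> Y"
      using z assms(3) invariant_conj_inv[OF assms(1,4)] by blast
    ultimately show "z \<otimes> z' \<in> X <#> Y"
      using set_multI[OF X(5)[OF z(1,4)] Y(5)] z(5) by simp
  qed
qed

lemma invariant_set_mult:
  assumes "subgroup H G" "X \<in> invariant_subgroups G H" "Y \<in> invariant_subgroups G H"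
  shows "X <#> Y \<in> invariant_subgroups G H"
proof -
  note X = invariant_subgroupsD[OF assms(2)] and Y = invariant_subgroupsD[OF assms(3)]
  have H: "h \<in> carrier G" if "h \<in> H" for h using assms(1) that by (rule subgroup.mem_carrier)
  have xc: "x \<in> carrier G" if "x \<in> X" for x using X(3) that by auto
  have yc: "x \<in> carrier G" if "x \<in> Y" for x using Y(3) that by auto
  have sub: "subgroup (X <#> Y) G" by (rule subgroup_set_mult[OF assms(1) X(1,2) assms(3)])
  have "h \<otimes> z \<otimes> inv h \<in> X <#> Y" if h: "h \<in> H" and "z \<in> X <#> Y" for h z
  proof -
    obtain x y where z: "x \<in> X" "y \<in> Y" "z = x \<otimes> y" using \<open>z \<in> X <#> Y\<close> by (auto simp: set_mult_def)
    have "h \<otimes> z \<otimes> inv h = (h \<otimes> x \<otimes> inv h) \<otimes> (h \<otimes> y \<otimes> inv h)"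
      using z xc yc H[OF h] by (simp add: m_assoc inv_cancel_left)
    then show ?thesis using set_multI[OF X(7)[OF h z(1)] Y(7)[OF h z(2)]] by simp
  qed
  moreover have "X <#> Y \<subseteq> H"
    using set_mult_least[OF assms(1) X(2) Y(2)] .
  ultimately show ?thesis using sub by (simp add: invariant_subgroups_def)
qed

lemma set_mult_upper:
  assumes "subgroup X G" "subgroup Y G"
  shows "X \<subseteq> X <#> Y" "Y \<subseteq> X <#> Y"
proof -
  note c = subgroup.one_closed[OF assms(1)] subgroup.one_closed[OF assms(2)]
  show "X \<subseteq> X <#> Y"
  proof
    fix x assume x: "x \<in> X"
    then have "x = x \<otimes> \<one>" using subgroup.mem_carrier[OF assms(1)] by simp
    then show "x \<in> X <#> Y" using set_multI[OF x c(2)] by simp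
  qed
  show "Y \<subseteq> X <#> Y"
  proof
    fix x assume x: "x \<in> Y"
    then have "x = \<one> \<otimes> x" using subgroup.mem_carrier[OF assms(2)] by simp
    then show "x \<in> X <#> Y" using set_multI[OF c(1) x] by simp
  qed
qed

text \<open>If \<open>y = x b\<close>, then \<open>b = inv x y\<close> lies in
  \<open>Y \<inter> B\<close>, hence in \<open>X\<close>. This form of Dedekind's law shows that a
  proper inclusion \<open>X \<subset> Y\<close> cannot vanish both in the products and in the
  intersections with \<open>B\<close>.\<close>

lemma modular_law:
  assumes X: "subgroup X G" and Y: "subgroup Y G" and B: "subgroup B G"
    and sub: "X \<subseteq> Y" and le: "Y \<subseteq> X <#> B" and int: "Y \<inter> B \<subseteq> X"
  shows "Y \<subseteq> X"
proof
  fix y assume y: "y \<in> Y"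
  then obtain x b where xb: "x \<in> X" "b \<in> B" "y = x \<otimes> b" using le by (auto simp: set_mult_def)
  then have "b = inv x \<otimes> y"
    using subgroup.mem_carrier[OF X] subgroup.mem_carrier[OF B] by (simp add: m_assoc[symmetric])
  then have "b \<in> Y" using xb y sub Y subgroup.m_inv_closed subgroup.m_closed by (metis subsetD)
  then have "b \<in> X" using int xb by auto
  then show "y \<in> X" using xb X subgroup.m_closed by metis
qed

section \<open>Trivial action on sections\<close>

lemma centralises_subgroup:
  assumes H: "subgroup H G" and "B \<in> invariant_subgroups G H" "A \<subseteq> H"
  shows "subgroup {g \<in> H. centralises G g A B} G"
proof (rule subgroupI)
  note B = invariant_subgroupsD[OF assms(2)]
  have c: "h \<in> carrier G" if "h \<in> H" for h using assms(1) that by (rule subgroup.mem_carrier)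
  show "{g \<in> H. centralises G g A B} \<subseteq> carrier G" using c by auto
  have "\<one> \<in> {g \<in> H. centralises G g A B}"
    using H B(4) c \<open>A \<subseteq> H\<close> by (auto simp: centralises_def subgroup.one_closed subset_iff)
  then show "{g \<in> H. centralises G g A B} \<noteq> {}" by blast
  fix g assume g: "g \<in> {g \<in> H. centralises G g A B}"
  have "inv g \<otimes> a \<otimes> inv (inv g) \<otimes> inv a \<in> B" if a: "a \<in> A" for a
  proof -
    have ac: "a \<in> carrier G" "g \<in> carrier G" using a \<open>A \<subseteq> H\<close> c g by auto
    \<comment> \<open>With \<open>[g, a] = g a inv g inv a\<close>, the identity used is
      \<open>[inv g, a] = inv g (inv [g, a]) g\<close>.\<close>
    have "inv (g \<otimes> a \<otimes> inv g \<otimes> inv a) \<in> B" using g a B(6) by (auto simp: centralises_def)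
    then have "inv g \<otimes> inv (g \<otimes> a \<otimes> inv g \<otimes> inv a) \<otimes> g \<in> B"
      using invariant_conj_inv[OF H assms(2)] g by blast
    then show ?thesis using ac by (simp add: inv_mult_group m_assoc)
  qed
  then show "inv g \<in> {g \<in> H. centralises G g A B}"
    using g H by (simp add: centralises_def subgroup.m_inv_closed)
  fix h assume h: "h \<in> {g \<in> H. centralises G g A B}"
  have "(g \<otimes> h) \<otimes> a \<otimes> inv (g \<otimes> h) \<otimes> inv a \<in> B" if a: "a \<in> A" for a
  proof -
    have ac: "a \<in> carrier G" "g \<in> carrier G" "h \<in> carrier G" using a \<open>A \<subseteq> H\<close> c g h by auto
    \<comment> \<open>The two factors of \<open>[g h, a] = (g [h, a] inv g) [g, a]\<close>.\<close>
    have "g \<otimes> (h \<otimes> a \<otimes> inv h \<otimes> inv a) \<otimes> inv g \<in> B" "g \<otimes> a \<otimes> inv g \<otimes> inv a \<in> B"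
      using g h a B(7) by (auto simp: centralises_def)
    then have "(g \<otimes> (h \<otimes> a \<otimes> inv h \<otimes> inv a) \<otimes> inv g) \<otimes> (g \<otimes> a \<otimes> inv g \<otimes> inv a) \<in> B"
      by (rule B(5))
    then show ?thesis using ac by (simp add: inv_mult_group m_assoc inv_cancel_left)
  qed
  then show "g \<otimes> h \<in> {g \<in> H. centralises G g A B}"
    using g h H by (simp add: centralises_def subgroup.m_closed)
qed

text \<open>The identity \<open>[h, a b] = [h, a] (a [h, b] inv a)\<close> reduces the claim to
  invariance of \<open>B\<close> under \<open>A\<close> and \<open>h\<close>, both inside
  \<open>H\<close>.\<close>

lemma centralises_set_mult:
  assumes "h \<in> H" "A \<subseteq> H" "B \<in> invariant_subgroups G H" "subgroup H G"
    and "centralises G h A B"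
  shows "centralises G h (A <#> B) B"
  unfolding centralises_def
proof
  note B = invariant_subgroupsD[OF assms(3)]
  have c: "h \<in> carrier G" if "h \<in> H" for h using assms(4) that by (rule subgroup.mem_carrier)
  fix z assume "z \<in> A <#> B"
  then obtain a b where ab: "a \<in> A" "b \<in> B" "z = a \<otimes> b" by (auto simp: set_mult_def)
  have cc: "a \<in> carrier G" "b \<in> carrier G" "h \<in> carrier G" using ab assms c B(3) by auto
  have "h \<otimes> a \<otimes> inv h \<otimes> inv a \<in> B" using assms(5) ab by (auto simp: centralises_def)
  moreover have "a \<otimes> ((h \<otimes> b \<otimes> inv h) \<otimes> inv b) \<otimes> inv a \<in> B"
    using B(5,6,7) ab assms by blast
  ultimately have "(h \<otimes> a \<otimes> inv h \<otimes> inv a) \<otimes> (a \<otimes> ((h \<otimes> b \<otimes> inv h) \<otimes> inv b) \<otimes> inv a) \<in> B"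
    by (rule B(5))
  then show "h \<otimes> z \<otimes> inv h \<otimes> inv z \<in> B"
    using cc ab by (simp add: inv_mult_group m_assoc inv_cancel_left)
qed

end

section \<open>Chief length\<close>

text \<open>The consequence of finite index that makes all chains above \<open>B\<close> finite, so
  that the maximum defining \<open>chief_length\<close> exists.\<close>

definition finite_overgroups :: "('a, 'b) monoid_scheme \<Rightarrow> 'a set \<Rightarrow> bool" where
  "finite_overgroups G B \<longleftrightarrow> finite {X. subgroup X G \<and> B \<subseteq> X}"

text \<open>The bottom \<open>B\<close> is excluded and the top \<open>A\<close> allowed, so for
  invariant \<open>B \<subset> A\<close> the cardinality of a maximal chain counts its
  factors.\<close>

definition invariant_chains ::
    "('a, 'b) monoid_scheme \<Rightarrow> 'a set \<Rightarrow> 'a set \<Rightarrow> 'a set \<Rightarrow> 'a set set set" where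
  "invariant_chains G H A B =
     {c. c \<subseteq> {X \<in> invariant_subgroups G H. B \<subset> X \<and> X \<subseteq> A} \<and> (\<forall>X \<in> c. \<forall>Y \<in> c. X \<subseteq> Y \<or> Y \<subseteq> X)}"

definition chief_length :: "('a, 'b) monoid_scheme \<Rightarrow> 'a set \<Rightarrow> 'a set \<Rightarrow> 'a set \<Rightarrow> nat" where
  "chief_length G H A B = Max (card ` invariant_chains G H A B)"

context group
begin

lemma invariant_chainsD:
  assumes "c \<in> invariant_chains G H A B"
  shows "X \<in> c \<Longrightarrow> X \<in> invariant_subgroups G H" "X \<in> c \<Longrightarrow> B \<subset> X" "X \<in> c \<Longrightarrow> X \<subseteq> A"
    and "X \<in> c \<Longrightarrow> Y \<in> c \<Longrightarrow> X \<subseteq> Y \<or> Y \<subseteq> X"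
proof -
  from assms have "c \<subseteq> {X \<in> invariant_subgroups G H. B \<subset> X \<and> X \<subseteq> A}"
    and tot: "\<forall>X \<in> c. \<forall>Y \<in> c. X \<subseteq> Y \<or> Y \<subseteq> X"
    unfolding invariant_chains_def by fast+
  then show "X \<in> c \<Longrightarrow> X \<in> invariant_subgroups G H" "X \<in> c \<Longrightarrow> B \<subset> X" "X \<in> c \<Longrightarrow> X \<subseteq> A"
    by auto
  show "X \<in> c \<Longrightarrow> Y \<in> c \<Longrightarrow> X \<subseteq> Y \<or> Y \<subseteq> X" using tot by simp
qed

lemma invariant_chainsI:
  assumes "\<And>X. X \<in> c \<Longrightarrow> X \<in> invariant_subgroups G H \<and> B \<subset> X \<and> X \<subseteq> A"
    and "\<And>X Y. X \<in> c \<Longrightarrow> Y \<in> c \<Longrightarrow> X \<subseteq> Y \<or> Y \<subseteq> X"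
  shows "c \<in> invariant_chains G H A B"
  unfolding invariant_chains_def using assms by (simp add: subset_iff)

lemma finite_overgroups_mono: "finite_overgroups G B \<Longrightarrow> B \<subseteq> C \<Longrightarrow> finite_overgroups G C"
  unfolding finite_overgroups_def by (erule rev_finite_subset) auto

lemma finite_invariant_interval:
  assumes "finite_overgroups G B"
  shows "finite {X \<in> invariant_subgroups G H. B \<subseteq> X \<and> P X}"
  using assms unfolding finite_overgroups_def
  by (rule rev_finite_subset) (auto simp: invariant_subgroups_def)

lemma finite_invariant_chain:
  assumes "finite_overgroups G B" "c \<in> invariant_chains G H A B"
  shows "finite c"
  using finite_invariant_interval[OF assms(1), of H "\<lambda>X. True"] assms(2)
  by (rule_tac finite_subset) (auto simp: invariant_chains_def)

lemma finite_invariant_chains: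
  assumes "finite_overgroups G B"
  shows "finite (invariant_chains G H A B)"
proof -
  have "invariant_chains G H A B \<subseteq> Pow {X \<in> invariant_subgroups G H. B \<subseteq> X \<and> True}"
    by (auto simp: invariant_chains_def)
  then show ?thesis
    using finite_invariant_interval[OF assms, of H "\<lambda>X. True"] finite_subset by blast
qed

lemma card_chain_le_chief_length:
  assumes "finite_overgroups G B" "c \<in> invariant_chains G H A B"
  shows "card c \<le> chief_length G H A B"
  unfolding chief_length_def using finite_invariant_chains[OF assms(1)] assms(2) by auto

lemma obtain_chief_length_chain:
  assumes "finite_overgroups G B"
  obtains c where "c \<in> invariant_chains G H A B" "card c = chief_length G H A B"
proof -
  have "{} \<in> invariant_chains G H A B" by (simp add: invariant_chains_def)
  then have "Max (card ` invariant_chains G H A B) \<in> card ` invariant_chains G H A B"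
    using finite_invariant_chains[OF assms] by (intro Max_in) auto
  then show ?thesis using that unfolding chief_length_def by auto
qed

lemma chief_length_le:
  assumes "finite_overgroups G B"
    and "\<And>c. c \<in> invariant_chains G H A B \<Longrightarrow> card c \<le> n"
  shows "chief_length G H A B \<le> n"
  using obtain_chief_length_chain[OF assms(1)] assms(2) by metis

text \<open>A chain remains a chain when the interval grows or the acting group shrinks;
  \<open>A \<subseteq> K\<close> keeps its members inside the smaller group.\<close>

lemma chief_length_mono:
  assumes "finite_overgroups G B'" "B' \<subseteq> B" "A \<subseteq> A'" "K \<subseteq> H" "A \<subseteq> K"
  shows "chief_length G H A B \<le> chief_length G K A' B'"
proof (rule chief_length_le)
  show "finite_overgroups G B" using assms finite_overgroups_mono by blast
  fix c assume "c \<in> invariant_chains G H A B"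
  then have "c \<in> invariant_chains G K A' B'"
  proof (intro invariant_chainsI)
    note c = invariant_chainsD[OF \<open>c \<in> invariant_chains G H A B\<close>]
    fix X assume "X \<in> c"
    then show "X \<in> invariant_subgroups G K \<and> B' \<subset> X \<and> X \<subseteq> A'"
      using c(1-3)[of X] assms(2-5) invariant_mono[of X H K] by auto
    fix Y assume "Y \<in> c"
    then show "X \<subseteq> Y \<or> Y \<subseteq> X" using c(4)[OF \<open>X \<in> c\<close>] by simp
  qed
  then show "card c \<le> chief_length G K A' B'" by (rule card_chain_le_chief_length[OF assms(1)])
qed

text \<open>A chain above \<open>B\<close> and a chain below \<open>B\<close> unite to one chain.
  They are disjoint, since only the lower one may contain \<open>B\<close>.\<close>

lemma chief_length_superadditive:
  assumes fin: "finite_overgroups G C" and "C \<subseteq> B" "B \<subseteq> A"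
  shows "chief_length G H A B + chief_length G H B C \<le> chief_length G H A C"
proof -
  have finB: "finite_overgroups G B" using fin assms(2) by (rule finite_overgroups_mono)
  obtain c where c: "c \<in> invariant_chains G H A B" "card c = chief_length G H A B"
    by (rule obtain_chief_length_chain[OF finB])
  obtain d where d: "d \<in> invariant_chains G H B C" "card d = chief_length G H B C"
    by (rule obtain_chief_length_chain[OF fin])
  have "X \<subseteq> Y" if "X \<in> d" "Y \<in> c" for X Y
  proof -
    have "X \<subseteq> B" "B \<subset> Y"
      using invariant_chainsD(3)[OF d(1) that(1)] invariant_chainsD(2)[OF c(1) that(2)] .
    then show ?thesis by auto
  qed
  note le = this
  have "c \<union> d \<in> invariant_chains G H A C"
  proof (rule invariant_chainsI)
    fix X assume "X \<in> c \<union> d"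
    then show "X \<in> invariant_subgroups G H \<and> C \<subset> X \<and> X \<subseteq> A"
      using invariant_chainsD(1-3)[OF c(1), of X] invariant_chainsD(1-3)[OF d(1), of X] assms(2,3)
      by auto
  next
    fix X Y assume "X \<in> c \<union> d" "Y \<in> c \<union> d"
    then show "X \<subseteq> Y \<or> Y \<subseteq> X"
      using invariant_chainsD(4)[OF c(1)] invariant_chainsD(4)[OF d(1)] le by (metis UnE)
  qed
  moreover have "card (c \<union> d) = card c + card d"
    using finite_invariant_chain[OF finB c(1)] finite_invariant_chain[OF fin d(1)]
      invariant_chainsD(2)[OF c(1)] invariant_chainsD(3)[OF d(1)]
    by (intro card_Un_disjoint) auto
  ultimately show ?thesis
    using card_chain_le_chief_length[OF fin] c(2) d(2) by metis
qed

text \<open>By the modular law, each strict step of a chain \<open>c\<close> stays strict in \<open>X \<mapsto> X B\<close> or in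
  \<open>X \<mapsto> X \<inter> B\<close>, so that \<open>X\<close> is determined by its total rank in the two image chains.\<close>

lemma chief_length_subadditive:
  assumes fin: "finite_overgroups G C" and H: "subgroup H G"
    and A: "A \<in> invariant_subgroups G H" and B: "B \<in> invariant_subgroups G H"
    and "C \<subseteq> B" "B \<subseteq> A" and C: "C \<in> invariant_subgroups G H"
  shows "chief_length G H A C \<le> chief_length G H A B + chief_length G H B C"
proof (rule chief_length_le[OF fin])
  fix c assume c: "c \<in> invariant_chains G H A C"
  have cX: "X \<in> invariant_subgroups G H" "C \<subset> X" "X \<subseteq> A" if "X \<in> c" for X
    using invariant_chainsD(1-3)[OF c that] .
  have tot: "X \<subseteq> Y \<or> Y \<subseteq> X" if "X \<in> c" "Y \<in> c" for X Y
    using invariant_chainsD(4)[OF c that] .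
  have finB: "finite_overgroups G B" using fin \<open>C \<subseteq> B\<close> by (rule finite_overgroups_mono)
  note sg = invariant_subgroupsD(1)
  \<comment> \<open>The images of \<open>c\<close> in the upper and the lower interval; the bottoms
    \<open>B\<close> and \<open>C\<close> are removed because chains exclude them.\<close>
  define u where "u = (\<lambda>X. X <#> B) ` c - {B}"
  define l where "l = (\<lambda>X. X \<inter> B) ` c - {C}"
  have u: "u \<in> invariant_chains G H A B"
  proof -
    have "X <#> B \<in> invariant_subgroups G H" "B \<subseteq> X <#> B" "X <#> B \<subseteq> A" if "X \<in> c" for X
      using cX[OF that] invariant_set_mult[OF H _ B] set_mult_upper[OF sg sg[OF B]]
        set_mult_least[OF sg[OF A]] \<open>B \<subseteq> A\<close> by auto
    moreover have "X <#> B \<subseteq> Y <#> B \<or> Y <#> B \<subseteq> X <#> B" if "X \<in> c" "Y \<in> c" for X Y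
      using tot[OF that] mono_set_mult[OF _ order_refl] by metis
    ultimately show ?thesis unfolding u_def by (intro invariant_chainsI) fastforce+
  qed
  have l: "l \<in> invariant_chains G H B C"
  proof -
    have "X \<inter> B \<in> invariant_subgroups G H" "C \<subseteq> X \<inter> B" if "X \<in> c" for X
      using cX[OF that] invariant_Int[OF _ B] \<open>C \<subseteq> B\<close> by auto
    moreover have "X \<inter> B \<subseteq> Y \<inter> B \<or> Y \<inter> B \<subseteq> X \<inter> B" if "X \<in> c" "Y \<in> c" for X Y
      using tot[OF that] by auto
    ultimately show ?thesis unfolding l_def by (intro invariant_chainsI) fastforce+
  qed
  have fu: "finite u" and fl: "finite l"
    using finite_invariant_chain[OF finB u] finite_invariant_chain[OF fin l] by auto
  \<comment> \<open>The rank of the image of \<open>X\<close> in \<open>u\<close> plus that in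
    \<open>l\<close>. It strictly increases along \<open>c\<close>, hence is injective
    there.\<close>
  define r where "r X = card {Y \<in> u. Y \<subseteq> X <#> B} + card {Y \<in> l. Y \<subseteq> X \<inter> B}" for X
  have strict: "r X < r Y" if "X \<in> c" "Y \<in> c" "X \<subset> Y" for X Y
  proof -
    note X = cX[OF that(1)] and Y = cX[OF that(2)]
    have le1: "{Z \<in> u. Z \<subseteq> X <#> B} \<subseteq> {Z \<in> u. Z \<subseteq> Y <#> B}"
      using mono_set_mult[of X Y B B] that(3) by auto
    have le2: "{Z \<in> l. Z \<subseteq> X \<inter> B} \<subseteq> {Z \<in> l. Z \<subseteq> Y \<inter> B}" using that(3) by auto
    have "\<not> (Y \<subseteq> X <#> B \<and> Y \<inter> B \<subseteq> X)"
      using modular_law[OF sg[OF X(1)] sg[OF Y(1)] sg[OF B]] that(3) by auto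
    then consider "\<not> Y \<subseteq> X <#> B" | "\<not> Y \<inter> B \<subseteq> X" by blast
    then show ?thesis
    proof cases
      case 1
      have "B \<subseteq> X <#> B" using set_mult_upper[OF sg[OF X(1)] sg[OF B]] by auto
      moreover have Y2: "Y \<subseteq> Y <#> B" using set_mult_upper[OF sg[OF Y(1)] sg[OF B]] by auto
      ultimately have "Y <#> B \<in> u" using that(2) 1 unfolding u_def by auto
      moreover have "\<not> Y <#> B \<subseteq> X <#> B" using Y2 1 by auto
      ultimately have "{Z \<in> u. Z \<subseteq> X <#> B} \<noteq> {Z \<in> u. Z \<subseteq> Y <#> B}" by auto
      then have "{Z \<in> u. Z \<subseteq> X <#> B} \<subset> {Z \<in> u. Z \<subseteq> Y <#> B}" using le1 by auto
      then have "card {Z \<in> u. Z \<subseteq> X <#> B} < card {Z \<in> u. Z \<subseteq> Y <#> B}"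
        using fu by (intro psubset_card_mono) auto
      moreover have "card {Z \<in> l. Z \<subseteq> X \<inter> B} \<le> card {Z \<in> l. Z \<subseteq> Y \<inter> B}"
        using le2 fl by (intro card_mono) auto
      ultimately show ?thesis by (simp add: r_def)
    next
      case 2
      then have "Y \<inter> B \<in> l" using that(2) X(2) unfolding l_def by auto
      moreover have "\<not> Y \<inter> B \<subseteq> X \<inter> B" using 2 by auto
      ultimately have "{Z \<in> l. Z \<subseteq> X \<inter> B} \<noteq> {Z \<in> l. Z \<subseteq> Y \<inter> B}"
        by (metis (mono_tags, lifting) mem_Collect_eq order_refl)
      then have "{Z \<in> l. Z \<subseteq> X \<inter> B} \<subset> {Z \<in> l. Z \<subseteq> Y \<inter> B}" using le2 by auto
      then have "card {Z \<in> l. Z \<subseteq> X \<inter> B} < card {Z \<in> l. Z \<subseteq> Y \<inter> B}"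
        using fl by (intro psubset_card_mono) auto
      moreover have "card {Z \<in> u. Z \<subseteq> X <#> B} \<le> card {Z \<in> u. Z \<subseteq> Y <#> B}"
        using le1 fu by (intro card_mono) auto
      ultimately show ?thesis by (simp add: r_def)
    qed
  qed
  have inj: "inj_on r c"
  proof (rule inj_onI)
    fix X Y assume XY: "X \<in> c" "Y \<in> c" "r X = r Y"
    show "X = Y"
    proof (rule ccontr)
      assume "X \<noteq> Y"
      then have "X \<subset> Y \<or> Y \<subset> X" using tot[OF XY(1,2)] by blast
      then show False using strict XY by (metis less_irrefl)
    qed
  qed
  have "r X \<in> {1..card u + card l}" if "X \<in> c" for X
  proof -
    note X = cX[OF that]
    \<comment> \<open>Rank zero would force \<open>X B = B\<close> and
      \<open>X \<inter> B = C\<close>, hence \<open>X = C\<close>. So the ranks start at 1 and no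
      extra unit enters the bound.\<close>
    have "r X \<noteq> 0"
    proof
      assume "r X = 0"
      then have "X <#> B \<notin> u" "X \<inter> B \<notin> l" using fu fl by (auto simp: r_def)
      then have "X <#> B = B" "X \<inter> B = C" using that by (auto simp: u_def l_def)
      then show False using X(2) set_mult_upper(1)[OF sg[OF X(1)] sg[OF B]] by auto
    qed
    moreover have "r X \<le> card u + card l"
      unfolding r_def using fu fl by (intro add_mono card_mono) auto
    ultimately show ?thesis by simp
  qed
  then have "card c \<le> card {1..card u + card l}"
    using inj by (intro card_inj_on_le[of r]) auto
  also have "\<dots> \<le> chief_length G H A B + chief_length G H B C"
    using card_chain_le_chief_length[OF finB u] card_chain_le_chief_length[OF fin l] by simp
  finally show "card c \<le> chief_length G H A B + chief_length G H B C" .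
qed

lemma chief_length_chief_factor:
  assumes "finite_overgroups G B" "chief_factor G H A B"
  shows "chief_length G H A B \<le> 1"
proof (rule chief_length_le[OF assms(1)])
  fix c assume "c \<in> invariant_chains G H A B"
  note c = invariant_chainsD[OF this]
  have "c \<subseteq> {A}"
  proof
    fix X assume "X \<in> c"
    then show "X \<in> {A}" using c(1-3)[of X] assms(2) unfolding chief_factor_def by auto
  qed
  then show "card c \<le> 1" using card_mono[of "{A}" c] by simp
qed

lemma chief_length_not_chief:
  assumes "finite_overgroups G B" "A \<in> invariant_subgroups G H" "B \<in> invariant_subgroups G H"
    and "B \<subset> A" "\<not> chief_factor G H A B"
  shows "2 \<le> chief_length G H A B"
proof -
  obtain X where X: "X \<in> invariant_subgroups G H" "B \<subseteq> X" "X \<subseteq> A" "X \<noteq> B" "X \<noteq> A"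
    using assms unfolding chief_factor_def by blast
  then have "{X, A} \<in> invariant_chains G H A B"
    using assms by (intro invariant_chainsI) auto
  then have "card {X, A} \<le> chief_length G H A B" by (rule card_chain_le_chief_length[OF assms(1)])
  then show ?thesis using X(5) by simp
qed

section \<open>Existence and covering of chief factors\<close>

text \<open>Finiteness of the interval allows \<open>B\<close> to be taken maximal among the
  invariant subgroups properly inside \<open>A\<close> and above \<open>R\<close>.\<close>

lemma obtain_chief_factor_below:
  assumes fin: "finite_overgroups G R"
    and A: "A \<in> invariant_subgroups G K" and R: "R \<in> invariant_subgroups G K" "R \<subset> A"
  obtains B where "chief_factor G K A B" "R \<subseteq> B"
proof -
  define S where "S = {X \<in> invariant_subgroups G K. R \<subseteq> X \<and> X \<subset> A}"
  have "finite S" using finite_invariant_interval[OF fin, of K] by (auto simp: S_def)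
  moreover have "R \<in> S" using R by (auto simp: S_def)
  ultimately obtain B where B: "B \<in> S" "\<And>X. X \<in> S \<Longrightarrow> B \<subseteq> X \<Longrightarrow> X = B"
    using finite_has_maximal[of S] by (metis empty_iff)
  have "chief_factor G K A B"
    unfolding chief_factor_def
  proof (intro conjI ballI impI)
    show "A \<in> invariant_subgroups G K" "B \<in> invariant_subgroups G K" "B \<subset> A"
      using A B(1) by (auto simp: S_def)
    fix X assume X: "X \<in> invariant_subgroups G K" "B \<subseteq> X \<and> X \<subseteq> A"
    have "X \<in> S" if "X \<noteq> A" using X that B(1) by (auto simp: S_def)
    then show "X = B \<or> X = A" using B(2) X(2) by blast
  qed
  then show ?thesis using that B(1) by (auto simp: S_def)
qed

text \<open>The covering step of the Jordan-Hoelder theorem without refining series: \<open>A\<close> is minimal among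
  the invariant subgroups that meet \<open>a\<close> outside \<open>b\<close>.\<close>

lemma obtain_covering_chief_factor:
  assumes fin: "finite_overgroups G R"
    and M: "M \<in> invariant_subgroups G K" and R: "R \<in> invariant_subgroups G K"
    and "R \<subseteq> M" "a \<subseteq> M" "R \<inter> a \<subseteq> b" "\<not> a \<subseteq> b"
  obtains A B where "chief_factor G K A B" "A \<subseteq> M" "R \<subseteq> B" "\<not> A \<inter> a \<subseteq> b" "B \<inter> a \<subseteq> b"
proof -
  define S where "S = {X \<in> invariant_subgroups G K. R \<subseteq> X \<and> (X \<subseteq> M \<and> \<not> X \<inter> a \<subseteq> b)}"
  have "finite S" "M \<in> S"
    using assms finite_invariant_interval[OF fin, of K] by (auto simp: S_def)
  then obtain A where A: "A \<in> S" "\<And>X. X \<in> S \<Longrightarrow> X \<subseteq> A \<Longrightarrow> X = A"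
    using finite_has_minimal[of S] by (metis empty_iff)
  have AS: "A \<in> invariant_subgroups G K" "R \<subseteq> A" "A \<subseteq> M" "\<not> A \<inter> a \<subseteq> b"
    using A(1) by (simp_all add: S_def)
  have "R \<subset> A" using AS(2,4) assms(6) by auto
  then obtain B where B: "chief_factor G K A B" "R \<subseteq> B"
    by (rule obtain_chief_factor_below[OF fin AS(1) R])
  have "B \<inter> a \<subseteq> b"
  proof (rule ccontr)
    assume "\<not> B \<inter> a \<subseteq> b"
    then have "B \<in> S" using AS(3) B by (auto simp: S_def chief_factor_def)
    then show False using A(2) B(1) by (auto simp: chief_factor_def)
  qed
  then show ?thesis using that[OF B(1)] B(2) AS by simp
qed

text \<open>The product is invariant, lies between \<open>b\<close> and \<open>a\<close>, and
  differs from \<open>b\<close>; irreducibility leaves only \<open>a\<close>.\<close>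

lemma chief_factor_eq_set_mult:
  assumes "subgroup H G" "chief_factor G H a b" "X \<in> invariant_subgroups G H" "X \<subseteq> a" "\<not> X \<subseteq> b"
  shows "X <#> b = a"
proof -
  have ab: "a \<in> invariant_subgroups G H" "b \<in> invariant_subgroups G H" "b \<subseteq> a"
    using assms(2) by (auto simp: chief_factor_def)
  note sg = invariant_subgroupsD(1)
  have "X <#> b \<in> invariant_subgroups G H" by (rule invariant_set_mult[OF assms(1,3) ab(2)])
  moreover have "b \<subseteq> X <#> b" "X \<subseteq> X <#> b"
    using set_mult_upper[OF sg[OF assms(3)] sg[OF ab(2)]] by auto
  moreover have "X <#> b \<subseteq> a" by (rule set_mult_least[OF sg[OF ab(1)] assms(4) ab(3)])
  ultimately show ?thesis using assms(2,5) unfolding chief_factor_def by blast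
qed

text \<open>For \<open>x \<in> A \<inter> a\<close> the commutator \<open>[h, x]\<close> lies in
  \<open>B \<inter> a\<close>, hence in \<open>b\<close>. Irreducibility gives
  \<open>(A \<inter> a) b = a\<close>, so the trivial action passes to all of
  \<open>a / b\<close>.\<close>

lemma centralises_covered:
  assumes "subgroup H G" "H \<subseteq> K" "chief_factor G H a b" "A \<in> invariant_subgroups G K"
    and "\<not> A \<inter> a \<subseteq> b" "B \<inter> a \<subseteq> b" "h \<in> H" "centralises G h A B"
  shows "centralises G h a b"
proof -
  have ab: "a \<in> invariant_subgroups G H" "b \<in> invariant_subgroups G H"
    using assms(3) by (auto simp: chief_factor_def)
  note aD = invariant_subgroupsD[OF ab(1)]
  have inv: "A \<inter> a \<in> invariant_subgroups G H" by (rule invariant_Int[OF assms(4) ab(1) assms(2)])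
  have "h \<otimes> x \<otimes> inv h \<otimes> inv x \<in> b" if x: "x \<in> A \<inter> a" for x
  proof -
    have "h \<otimes> x \<otimes> inv h \<otimes> inv x \<in> a" using x assms(7) aD(5-7) by blast
    moreover have "h \<otimes> x \<otimes> inv h \<otimes> inv x \<in> B" using x assms(8) by (auto simp: centralises_def)
    ultimately show ?thesis using assms(6) by blast
  qed
  then have "centralises G h (A \<inter> a) b" by (simp add: centralises_def)
  then have "centralises G h ((A \<inter> a) <#> b) b"
    using centralises_set_mult[OF assms(7) _ ab(2) assms(1)] aD(2) by blast
  then show ?thesis
    using chief_factor_eq_set_mult[OF assms(1,3) inv] assms(5) by auto
qed

end

section \<open>Images under injective endomorphisms\<close>

context group
begin

lemma image_invariant:
  assumes f: "f \<in> hom G G" and X: "X \<in> invariant_subgroups G (carrier G)"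
  shows "f ` X \<in> invariant_subgroups G (f ` carrier G)"
proof -
  interpret f: group_hom G G f
    using f by unfold_locales
  note XD = invariant_subgroupsD[OF X]
  have "f g \<otimes> f x \<otimes> inv (f g) \<in> f ` X" if "g \<in> carrier G" "x \<in> X" for g x
  proof -
    have "f g \<otimes> f x \<otimes> inv (f g) = f (g \<otimes> x \<otimes> inv g)" using that XD(3) by auto
    then show ?thesis using XD(7)[OF that] by simp
  qed
  then show ?thesis
    using f.subgroup_img_is_subgroup[OF XD(1)] XD(3) by (auto simp: invariant_subgroups_def)
qed

lemma preimage_invariant:
  assumes f: "f \<in> hom G G" and Y: "Y \<in> invariant_subgroups G (f ` carrier G)"
  shows "{x \<in> carrier G. f x \<in> Y} \<in> invariant_subgroups G (carrier G)"
proof -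
  interpret f: group_hom G G f
    using f by unfold_locales
  note YD = invariant_subgroupsD[OF Y]
  have "subgroup {x \<in> carrier G. f x \<in> Y} G"
    using YD(4-6) by (intro subgroupI) auto
  moreover have "f (g \<otimes> x \<otimes> inv g) \<in> Y" if "g \<in> carrier G" "x \<in> carrier G" "f x \<in> Y" for g x
    using that YD(7)[of "f g" "f x"] by auto
  ultimately show ?thesis by (auto simp: invariant_subgroups_def)
qed

lemma image_preimage:
  assumes "Y \<subseteq> f ` carrier G"
  shows "f ` {x \<in> carrier G. f x \<in> Y} = Y"
  using assms by auto

text \<open>Taking preimages under the isomorphism of \<open>G\<close> onto \<open>f(G)\<close>
  carries any subgroup strictly between back to \<open>G\<close>.\<close>

lemma image_chief_factor:
  assumes f: "f \<in> hom G G" "inj_on f (carrier G)" and AB: "chief_factor G (carrier G) A B"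
  shows "chief_factor G (f ` carrier G) (f ` A) (f ` B)"
proof -
  have inv: "A \<in> invariant_subgroups G (carrier G)" "B \<in> invariant_subgroups G (carrier G)" "B \<subset> A"
    using AB by (auto simp: chief_factor_def)
  note sub = invariant_subgroupsD(2)[OF inv(1)] invariant_subgroupsD(2)[OF inv(2)]
  have "f ` B \<subset> f ` A" using inv(3) f(2) sub(1) by (metis image_strict_mono inj_on_subset)
  moreover have "Y = f ` B \<or> Y = f ` A"
    if Y: "Y \<in> invariant_subgroups G (f ` carrier G)" and le: "f ` B \<subseteq> Y" "Y \<subseteq> f ` A" for Y
  proof -
    let ?X = "{x \<in> carrier G. f x \<in> Y}"
    have "f ` ?X = Y" using invariant_subgroupsD(2)[OF Y] by (rule image_preimage)
    moreover have "B \<subseteq> ?X" using le(1) sub by auto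
    moreover have "?X \<subseteq> A" using le(2) sub f(2) by (auto dest: inj_onD)
    moreover have "?X = B \<or> ?X = A"
      using AB preimage_invariant[OF f(1) Y] calculation(2,3) unfolding chief_factor_def by simp
    ultimately show ?thesis by auto
  qed
  ultimately show ?thesis
    using image_invariant[OF f(1) inv(1)] image_invariant[OF f(1) inv(2)]
    unfolding chief_factor_def by auto
qed

text \<open>Chains pull back along \<open>f\<close>, and distinct members have distinct preimages
  because each lies in the image of \<open>f\<close>.\<close>

lemma image_chief_length:
  assumes f: "f \<in> hom G G" "inj_on f (carrier G)"
    and fin: "finite_overgroups G B" "finite_overgroups G (f ` B)"
    and sub: "A \<subseteq> carrier G" "B \<subseteq> carrier G"
  shows "chief_length G (f ` carrier G) (f ` A) (f ` B) \<le> chief_length G (carrier G) A B"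
proof (rule chief_length_le[OF fin(2)])
  fix c assume c: "c \<in> invariant_chains G (f ` carrier G) (f ` A) (f ` B)"
  note cD = invariant_chainsD[OF c]
  let ?p = "\<lambda>Y. {x \<in> carrier G. f x \<in> Y}"
  have im: "f ` ?p Y = Y" if "Y \<in> c" for Y
    using invariant_subgroupsD(2)[OF cD(1)[OF that]] by (rule image_preimage)
  have "?p ` c \<in> invariant_chains G (carrier G) A B"
  proof (rule invariant_chainsI)
    fix X assume "X \<in> ?p ` c"
    then obtain Y where Y: "Y \<in> c" "X = ?p Y" by blast
    have "X \<in> invariant_subgroups G (carrier G)"
      using preimage_invariant[OF f(1) cD(1)[OF Y(1)]] Y(2) by simp
    moreover have "B \<subseteq> X" using cD(2)[OF Y(1)] Y(2) sub(2) by auto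
    moreover have "X \<noteq> B" using cD(2)[OF Y(1)] im[OF Y(1)] Y(2) by auto
    moreover have "X \<subseteq> A" using cD(3)[OF Y(1)] Y(2) sub(1) f(2) by (auto dest: inj_onD)
    ultimately show "X \<in> invariant_subgroups G (carrier G) \<and> B \<subset> X \<and> X \<subseteq> A" by auto
  next
    fix X X' assume "X \<in> ?p ` c" "X' \<in> ?p ` c"
    then obtain Y Y' where "Y \<in> c" "X = ?p Y" "Y' \<in> c" "X' = ?p Y'" by blast
    moreover from this have "Y \<subseteq> Y' \<or> Y' \<subseteq> Y" using cD(4) by simp
    ultimately show "X \<subseteq> X' \<or> X' \<subseteq> X" by blast
  qed
  moreover have "inj_on ?p c" using im by (rule inj_on_inverseI)
  ultimately show "card c \<le> chief_length G (carrier G) A B"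
    using card_chain_le_chief_length[OF fin(1), of "?p ` c"] card_image[of ?p c] by simp
qed

lemma image_centralises:
  assumes f: "f \<in> hom G G" "inj_on f (carrier G)"
    and "A \<subseteq> carrier G" "B \<subseteq> carrier G" "x \<in> carrier G" "centralises G (f x) (f ` A) (f ` B)"
  shows "centralises G x A B"
  unfolding centralises_def
proof
  interpret f: group_hom G G f
    using f by unfold_locales
  fix a assume a: "a \<in> A"
  then have ac: "a \<in> carrier G" using assms(3) by auto
  have "f x \<otimes> f a \<otimes> inv (f x) \<otimes> inv (f a) \<in> f ` B" using assms(6) a by (auto simp: centralises_def)
  then have "f (x \<otimes> a \<otimes> inv x \<otimes> inv a) \<in> f ` B" using ac assms(5) by simp
  then show "x \<otimes> a \<otimes> inv x \<otimes> inv a \<in> B"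
    using inj_on_image_mem_iff[OF f(2) _ assms(4), of "x \<otimes> a \<otimes> inv x \<otimes> inv a"] ac assms(5) by simp
qed

section \<open>Coset coverings and finite index\<close>

lemma covered_by_cosets_image:
  assumes f: "f \<in> hom G G" and "B \<subseteq> carrier G" "covered_by_cosets G A B k"
  shows "covered_by_cosets G (f ` A) (f ` B) k"
proof -
  interpret f: group_hom G G f
    using f by unfold_locales
  obtain F where F: "finite F" "card F \<le> k" "F \<subseteq> carrier G" "A \<subseteq> (\<Union>g \<in> F. g <# B)"
    using assms(3) by (auto simp: covered_by_cosets_def)
  have "f a \<in> (\<Union>g \<in> f ` F. g <# (f ` B))" if "a \<in> A" for a
  proof -
    obtain g b where "g \<in> F" "b \<in> B" "a = g \<otimes> b"
      using F(4) \<open>a \<in> A\<close> by (auto simp: l_coset_def)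
    moreover from this have "g \<in> carrier G" "b \<in> carrier G" using F(3) assms(2) by auto
    ultimately have "f a = f g \<otimes> f b" by simp
    then show ?thesis using \<open>g \<in> F\<close> \<open>b \<in> B\<close> unfolding l_coset_def by blast
  qed
  then show ?thesis
    using F card_image_le[OF F(1), of f] unfolding covered_by_cosets_def
    by (intro exI[of _ "f ` F"]) auto
qed

lemma covered_by_cosets_mono:
  assumes "covered_by_cosets G A B k" "A' \<subseteq> A" "B \<subseteq> B'"
  shows "covered_by_cosets G A' B' k"
proof -
  obtain F where F: "finite F" "card F \<le> k" "F \<subseteq> carrier G" "A \<subseteq> (\<Union>f \<in> F. f <# B)"
    using assms(1) by (auto simp: covered_by_cosets_def)
  have "(\<Union>f \<in> F. f <# B) \<subseteq> (\<Union>f \<in> F. f <# B')"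
    using assms(3) by (intro UN_mono order_refl) (auto simp: l_coset_def)
  then have "A' \<subseteq> (\<Union>f \<in> F. f <# B')" using F(4) assms(2) by order
  then show ?thesis using F(1-3) unfolding covered_by_cosets_def by auto
qed

lemma covered_by_cosets_finite_index:
  assumes B: "B \<in> invariant_subgroups G (carrier G)" and fin: "finite (rcosets B)"
  shows "\<exists>k. covered_by_cosets G (carrier G) B k"
proof -
  note BD = invariant_subgroupsD[OF B]
  define r where "r C = (SOME x. x \<in> carrier G \<and> C = B #> x)" for C
  have r: "r C \<in> carrier G \<and> C = B #> r C" if "C \<in> rcosets B" for C
    unfolding r_def by (rule someI_ex) (use that in \<open>auto simp: RCOSETS_def\<close>)
  have "g \<in> (\<Union>x \<in> r ` (rcosets B). x <# B)" if g: "g \<in> carrier G" for g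
  proof -
    have C: "B #> g \<in> rcosets B" using rcosetsI[OF BD(3) g] .
    let ?x = "r (B #> g)"
    have x: "?x \<in> carrier G" "B #> g = B #> ?x" using r[OF C] by auto
    have "g \<in> B #> ?x" using rcos_self[OF g BD(1)] x(2) by simp
    then obtain b where b: "b \<in> B" "g = b \<otimes> ?x" by (auto simp: r_coset_def)
    have "b \<in> carrier G" using b(1) BD(3) by auto
    \<comment> \<open>Normality turns the right coset of \<open>?x\<close> into the left coset
      required by the covering.\<close>
    then have "?x \<otimes> (inv ?x \<otimes> b \<otimes> ?x) = b \<otimes> ?x"
      using x(1) by (simp add: m_assoc inv_cancel_left)
    then have "g = ?x \<otimes> (inv ?x \<otimes> b \<otimes> ?x)"
      using b(2) by simp
    moreover have "inv ?x \<otimes> b \<otimes> ?x \<in> B"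
      using invariant_conj_inv[OF subgroup_self B x(1) b(1)] .
    ultimately have "g \<in> ?x <# B" by (auto simp: l_coset_def)
    then show ?thesis using C by blast
  qed
  moreover have "r ` (rcosets B) \<subseteq> carrier G" using r by auto
  ultimately show ?thesis
    using fin unfolding covered_by_cosets_def by (metis finite_imageI order_refl subsetI)
qed

text \<open>An overgroup is the union of the cosets of \<open>B\<close> that it contains, so it is
  determined by a subset of a finite set.\<close>

lemma finite_overgroups_finite_index:
  assumes B: "subgroup B G" and fin: "finite (rcosets B)"
  shows "finite_overgroups G B"
proof -
  have "X = \<Union>{C \<in> rcosets B. C \<subseteq> X}" if X: "subgroup X G" "B \<subseteq> X" for X
  proof
    show "X \<subseteq> \<Union>{C \<in> rcosets B. C \<subseteq> X}"
    proof
      fix x assume x: "x \<in> X"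
      then have xc: "x \<in> carrier G" using X(1) subgroup.mem_carrier by metis
      have "B #> x \<subseteq> X" using X x subgroup.m_closed[OF X(1)] by (auto simp: r_coset_def)
      moreover have "x \<in> B #> x" "B #> x \<in> rcosets B"
        using rcos_self[OF xc B] rcosetsI[OF subgroup.subset[OF B] xc] by auto
      ultimately show "x \<in> \<Union>{C \<in> rcosets B. C \<subseteq> X}" by blast
    qed
  qed auto
  then have "{X. subgroup X G \<and> B \<subseteq> X} \<subseteq> Union ` Pow (rcosets B)" by blast
  then show ?thesis unfolding finite_overgroups_def using fin finite_subset by blast
qed

text \<open>Orbit-stabiliser: the subgroup in question stabilises \<open>a B\<close> under
  conjugation on \<open>A / B\<close>, and the orbit has at most \<open>k\<close> elements.\<close>

lemma card_rcosets_centraliser_le: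
  assumes "A \<in> invariant_subgroups G (carrier G)" "B \<in> invariant_subgroups G (carrier G)"
    and cov: "covered_by_cosets G A B k" and a: "a \<in> A"
  shows "card (rcosets {g \<in> carrier G. centralises G g {a} B}) \<le> k"
proof -
  note AD = invariant_subgroupsD[OF assms(1)] and BD = invariant_subgroupsD[OF assms(2)]
  let ?S = "{g \<in> carrier G. centralises G g {a} B}"
  have ac: "a \<in> carrier G" using a AD(3) by auto
  have S: "subgroup ?S G" using centralises_subgroup[OF subgroup_self assms(2), of "{a}"] ac by auto
  obtain F where F: "finite F" "card F \<le> k" "F \<subseteq> carrier G" "A \<subseteq> (\<Union>g \<in> F. g <# B)"
    using cov by (auto simp: covered_by_cosets_def)
  define r where "r C = (SOME x. x \<in> carrier G \<and> C = ?S #> x)" for C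
  have r: "r C \<in> carrier G \<and> C = ?S #> r C" if "C \<in> rcosets ?S" for C
    unfolding r_def by (rule someI_ex) (use that in \<open>auto simp: RCOSETS_def\<close>)
  \<comment> \<open>The coset \<open>?S x\<close> is sent to a member of \<open>F\<close> whose left
    coset of \<open>B\<close> contains the conjugate \<open>inv x a x\<close>.\<close>
  define \<phi> where "\<phi> C = (SOME g. g \<in> F \<and> inv (r C) \<otimes> a \<otimes> r C \<in> g <# B)" for C
  have \<phi>: "\<phi> C \<in> F \<and> inv (r C) \<otimes> a \<otimes> r C \<in> \<phi> C <# B" if "C \<in> rcosets ?S" for C
  proof -
    have "inv (r C) \<otimes> a \<otimes> r C \<in> A"
      using invariant_conj_inv[OF subgroup_self assms(1) _ a] r[OF that] by auto
    then have "\<exists>g. g \<in> F \<and> inv (r C) \<otimes> a \<otimes> r C \<in> g <# B" using F(4) by blast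
    then show ?thesis unfolding \<phi>_def by (rule someI_ex)
  qed
  have "inj_on \<phi> (rcosets ?S)"
  proof (rule inj_onI)
    fix C D assume C: "C \<in> rcosets ?S" and D: "D \<in> rcosets ?S" and eq: "\<phi> C = \<phi> D"
    let ?x = "r C" and ?y = "r D"
    have x: "?x \<in> carrier G" and y: "?y \<in> carrier G" using r C D by auto
    obtain b where b: "b \<in> B" "inv ?x \<otimes> a \<otimes> ?x = \<phi> C \<otimes> b"
      using \<phi>[OF C] by (auto simp: l_coset_def)
    obtain d where d: "d \<in> B" "inv ?y \<otimes> a \<otimes> ?y = \<phi> C \<otimes> d"
      using \<phi>[OF D] eq by (auto simp: l_coset_def)
    have pc: "\<phi> C \<in> carrier G" "b \<in> carrier G" "d \<in> carrier G" using \<phi>[OF C] F(3) BD(3) b d by auto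
    have eqx: "a = ?x \<otimes> (\<phi> C \<otimes> b) \<otimes> inv ?x"
      using b(2)[symmetric] x ac by (simp add: m_assoc inv_cancel_left)
    have p: "\<phi> C = inv ?y \<otimes> a \<otimes> ?y \<otimes> inv d"
      using d(2) pc by (simp add: m_assoc)
    have "(?y \<otimes> inv ?x) \<otimes> a \<otimes> inv (?y \<otimes> inv ?x) \<otimes> inv a
        = ?y \<otimes> (inv ?x \<otimes> a \<otimes> ?x) \<otimes> inv ?y \<otimes> inv a"
      using x y ac by (simp add: m_assoc inv_mult_group)
    \<comment> \<open>Both conjugates of \<open>a\<close> lie in the same coset
      \<open>\<phi> C B\<close>; eliminating \<open>\<phi> C\<close> leaves a conjugate of
      \<open>inv d b\<close>.\<close>
    also have "\<dots> = a \<otimes> (?y \<otimes> (inv d \<otimes> b) \<otimes> inv ?y) \<otimes> inv a"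
      unfolding b(2) using x y ac pc by (subst p) (simp add: m_assoc inv_cancel_left)
    also have "\<dots> \<in> B"
      using BD(5-7) b d ac y by simp
    finally have "?y \<otimes> inv ?x \<in> ?S" using x y by (simp add: centralises_def)
    moreover have "?y = (?y \<otimes> inv ?x) \<otimes> ?x" using x y by (simp add: m_assoc)
    ultimately have "?y \<in> ?S #> ?x" unfolding r_coset_def by blast
    then have "?S #> ?x = ?S #> ?y" by (rule repr_independence[OF _ x S])
    moreover have "C = ?S #> ?x" "D = ?S #> ?y" using r[OF C] r[OF D] by blast+
    ultimately show "C = D" by argo
  qed
  then have "card (rcosets ?S) \<le> card F"
    using \<phi> F(1) by (intro card_inj_on_le[of \<phi>]) auto
  then show ?thesis using F(2) by simp
qed

end

section \<open>Contracted elements centralise chief factors\<close>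

text \<open>The algebraic content of type (F). Openness of \<open>S\<close> is expressed as
  \<open>N n \<subseteq> S\<close> for some \<open>n\<close>; \<open>N_index\<close> makes
  \<open>N k\<close> lie below every such subgroup of index at most \<open>k\<close>.\<close>

locale filtered_group = group G for G (structure) +
  fixes N :: "nat \<Rightarrow> 'a set"
  assumes N_invariant: "N n \<in> invariant_subgroups G (carrier G)"
    and N_antimono: "m \<le> n \<Longrightarrow> N n \<subseteq> N m"
    and N_finite_index: "finite (rcosets (N n))"
    and N_index: "subgroup S G \<Longrightarrow> N n \<subseteq> S \<Longrightarrow> card (rcosets S) \<le> k \<Longrightarrow> N k \<subseteq> S"
begin

lemma N_subgroup: "subgroup (N n) G"
  using N_invariant by (rule invariant_subgroupsD)

lemma N_subset: "N n \<subseteq> carrier G"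
  using N_subgroup by (rule subgroup.subset)

lemma N_finite_overgroups: "N n \<subseteq> B \<Longrightarrow> finite_overgroups G B"
  using finite_overgroups_finite_index[OF N_subgroup N_finite_index] finite_overgroups_mono by blast

text \<open>Each \<open>a \<in> A\<close> has a stabiliser modulo \<open>B\<close> of index at most
  \<open>k\<close>, and \<open>N_index\<close> puts \<open>N k\<close> inside it. The choice of
  \<open>N k\<close> depends on \<open>k\<close> alone, not on the factor.\<close>

lemma centralises_covered_by_cosets:
  assumes "A \<in> invariant_subgroups G (carrier G)" "B \<in> invariant_subgroups G (carrier G)"
    and "N n \<subseteq> B" "covered_by_cosets G A B k" "x \<in> N k"
  shows "centralises G x A B"
  unfolding centralises_def
proof
  fix a assume a: "a \<in> A"
  note AD = invariant_subgroupsD[OF assms(1)] and BD = invariant_subgroupsD[OF assms(2)]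
  let ?S = "{g \<in> carrier G. centralises G g {a} B}"
  have ac: "a \<in> carrier G" using a AD(3) by auto
  \<comment> \<open>\<open>B\<close> acts trivially on the coset of \<open>a\<close>, so the
    stabiliser contains \<open>N n\<close> and \<open>N_index\<close> applies.\<close>
  have "b \<otimes> a \<otimes> inv b \<otimes> inv a \<in> B" if b: "b \<in> B" for b
  proof -
    have "b \<otimes> (a \<otimes> inv b \<otimes> inv a) \<in> B" using b BD(5-7) ac by blast
    moreover have "b \<in> carrier G" using b BD(3) by auto
    ultimately show ?thesis using ac by (simp add: m_assoc)
  qed
  then have "N n \<subseteq> ?S" using assms(3) BD(3) by (auto simp: centralises_def)
  moreover have "subgroup ?S G"
    using centralises_subgroup[OF subgroup_self assms(2), of "{a}"] ac by auto
  ultimately have "N k \<subseteq> ?S"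
    using card_rcosets_centraliser_le[OF assms(1,2,4) a] N_index by blast
  then show "x \<otimes> a \<otimes> inv x \<otimes> inv a \<in> B" using assms(5) by (auto simp: centralises_def)
qed

end

text \<open>The algebraic trace of \<open>End_o\<close>: continuity enters through
  \<open>f_N\<close>, openness of the image through \<open>f_open\<close>.\<close>

locale filtered_group_endo = filtered_group +
  fixes f :: "'a \<Rightarrow> 'a"
  assumes f_hom: "f \<in> hom G G"
    and f_inj: "inj_on f (carrier G)"
    and f_N: "f ` N n \<subseteq> N n"
    and f_open: "\<exists>m. N m \<subseteq> f ` N n"
begin

lemma f_closed: "x \<in> carrier G \<Longrightarrow> f x \<in> carrier G"
  using f_hom by (auto simp: hom_def)

lemma funpow_filtered_group_endo: "filtered_group_endo G N (f ^^ n)"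
proof (induction n)
  case 0
  show ?case by unfold_locales (auto simp: hom_def)
next
  case (Suc n)
  interpret g: filtered_group_endo G N "f ^^ n" by (rule Suc.IH)
  show ?case
  proof unfold_locales
    show "f ^^ Suc n \<in> hom G G"
      using g.f_closed f_closed hom_mult[OF g.f_hom] hom_mult[OF f_hom] by (intro homI) auto
    show "inj_on (f ^^ Suc n) (carrier G)"
      using g.f_inj inj_on_subset[OF f_inj, of "(f ^^ n) ` carrier G"] g.f_closed
      by (auto intro!: comp_inj_on)
    show "(f ^^ Suc n) ` N k \<subseteq> N k" for k
      using g.f_N[of k] f_N[of k] by (auto simp: image_subset_iff)
    show "\<exists>m. N m \<subseteq> (f ^^ Suc n) ` N k" for k
    proof -
      obtain l where "N l \<subseteq> (f ^^ n) ` N k" using g.f_open by blast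
      moreover obtain m where "N m \<subseteq> f ` N l" using f_open by blast
      ultimately have "N m \<subseteq> f ` (f ^^ n) ` N k" by blast
      then show ?thesis by (auto simp: image_comp)
    qed
  qed
qed

text \<open>Restriction to \<open>H = f(G)\<close> can only refine a chief series of \<open>G\<close>. Comparing the length of
  the refined series below \<open>N m \<le> H\<close> with the image of the series itself bounds the number of
  refinements by the length of \<open>G / N m\<close>, so no factor far enough down is refined.\<close>

lemma eventually_chief_factor_image:
  "\<exists>j. \<forall>A B n. chief_factor G (carrier G) A B \<and> A \<subseteq> N j \<and> N n \<subseteq> B \<longrightarrow>
     chief_factor G (f ` carrier G) A B"
proof -
  let ?C = "carrier G" and ?H = "f ` carrier G"
  interpret f: group_hom G G f
    using f_hom by unfold_locales
  have H: "subgroup ?H G" by (rule f.img_is_subgroup)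
  obtain m where "N m \<subseteq> f ` N 0" using f_open by blast
  then have m: "N m \<subseteq> ?H" using N_subset by blast
  define lH where "lH A B = chief_length G ?H A B" for A B
  define lG where "lG A B = chief_length G ?C A B" for A B
  have HC: "?H \<subseteq> ?C" using f_closed by auto
  have invH: "X \<in> invariant_subgroups G ?H" if "X \<in> invariant_subgroups G ?C" "X \<subseteq> N m" for X
    using that m invariant_mono[OF that(1) HC] by auto
  have le: "lG A B \<le> lH A B" if "A \<subseteq> N m" "N n \<subseteq> B" for A B n
    using that m chief_length_mono[OF N_finite_overgroups[OF that(2)] order_refl order_refl HC]
    unfolding lG_def lH_def by auto
  \<comment> \<open>The interval is first widened to \<open>f(G) / f(N j)\<close>, using
    \<open>N m \<subseteq> f(G)\<close> and \<open>f(N j) \<subseteq> N j\<close>; then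
    \<open>f\<close> transports it back to \<open>G / N j\<close>, which splits at
    \<open>N m\<close>.\<close>
  have bound: "lH (N m) (N j) \<le> lG ?C (N m) + lG (N m) (N j)" if "m \<le> j" for j
  proof -
    obtain n where n: "N n \<subseteq> f ` N j" using f_open by blast
    have "lH (N m) (N j) \<le> lH (f ` ?C) (f ` N j)"
      unfolding lH_def using f_N m
      by (intro chief_length_mono N_finite_overgroups[OF n]) auto
    also have "\<dots> \<le> lG ?C (N j)"
      unfolding lH_def lG_def using n N_subset
      by (intro image_chief_length f_hom f_inj N_finite_overgroups[of j] N_finite_overgroups[of n]) auto
    also have "\<dots> \<le> lG ?C (N m) + lG (N m) (N j)"
      unfolding lG_def
      using N_antimono[OF that] N_subset subgroup_self N_invariant
      by (intro chief_length_subadditive N_finite_overgroups[of j])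
        (auto simp: invariant_subgroups_def)
    finally show ?thesis .
  qed
  \<comment> \<open>The number of refinements caused by restriction to \<open>f(G)\<close>. It is
    bounded for \<open>j \<ge> m\<close>, so a maximising \<open>j\<close> exists.\<close>
  define d where "d j = lH (N m) (N j) - lG (N m) (N j)" for j
  obtain j where j: "m \<le> j" "\<And>i. m \<le> i \<Longrightarrow> d i \<le> d j"
    using ex_has_greatest_nat[of "\<lambda>j. m \<le> j" m d "Suc (lG ?C (N m))"] bound
    by (auto simp: d_def le_diff_conv less_Suc_eq_le)
  have "chief_factor G ?H A B"
    if AB: "chief_factor G ?C A B" and Aj: "A \<subseteq> N j" and n: "N n \<subseteq> B" for A B n
  proof (rule ccontr)
    assume not: "\<not> chief_factor G ?H A B"
    \<comment> \<open>Large enough for \<open>N i\<close> to lie below \<open>B\<close> and for the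
      maximality of \<open>d j\<close> to apply.\<close>
    define i where "i = max j n"
    have i: "m \<le> i" "N i \<subseteq> B" "N i \<subseteq> N n" "N j \<subseteq> N m"
      using j(1) n N_antimono[of n i] N_antimono[of m j] by (auto simp: i_def)
    have inv: "A \<in> invariant_subgroups G ?C" "B \<in> invariant_subgroups G ?C" "B \<subset> A"
      using AB by (auto simp: chief_factor_def)
    have finB: "finite_overgroups G B" and finA: "finite_overgroups G A"
      and finj: "finite_overgroups G (N j)" and fini: "finite_overgroups G (N i)"
      using N_finite_overgroups[OF n] finite_overgroups_mono inv(3) N_finite_overgroups by auto
    have "2 \<le> lH A B"
      unfolding lH_def using inv Aj i(4) not
      by (intro chief_length_not_chief[OF finB] invH) auto
    moreover have "lG A B \<le> 1" unfolding lG_def by (rule chief_length_chief_factor[OF finB AB])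
    \<comment> \<open>Along \<open>N m\<close>, \<open>N j\<close>, \<open>A\<close>,
      \<open>B\<close>, \<open>N i\<close> the \<open>lH\<close> terms are superadditive and the
      \<open>lG\<close> terms subadditive. The refined factor \<open>A / B\<close> adds at least
      one, so \<open>d i\<close> would exceed \<open>d j\<close>.\<close>
    moreover have "lH (N m) (N j) + lH (N j) (N i) \<le> lH (N m) (N i)"
      "lH (N j) A + lH A (N i) \<le> lH (N j) (N i)" "lH A B + lH B (N i) \<le> lH A (N i)"
      unfolding lH_def using i inv(3) Aj by (auto intro!: chief_length_superadditive[OF fini])
    moreover have "lG (N m) (N i) \<le> lG (N m) (N j) + lG (N j) (N i)"
      "lG (N j) (N i) \<le> lG (N j) A + lG A (N i)" "lG A (N i) \<le> lG A B + lG B (N i)"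
      unfolding lG_def using i inv Aj
      by (auto intro!: chief_length_subadditive[OF fini] subgroup_self N_invariant)
    moreover have "lG (N m) (N j) \<le> lH (N m) (N j)" "lG (N j) A \<le> lH (N j) A"
      "lG B (N i) \<le> lH B (N i)"
      using i inv(3) Aj le[of "N m" j "N j"] le[of "N j" n A] le[of B i "N i"] n by auto
    ultimately have "d j < d i" unfolding d_def by linarith
    then show False using j(2)[OF i(1)] by simp
  qed
  then show ?thesis by blast
qed

text \<open>One step of the iteration. The factor \<open>f(A) / f(B)\<close> of \<open>f(G)\<close>
  is covered by a chief factor \<open>A' / B'\<close> of \<open>G\<close> below \<open>N j\<close>.
  As \<open>A' / B'\<close> stays irreducible under \<open>f(G)\<close>, the covering is an
  isomorphism and the bound \<open>k\<close> is preserved.\<close>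

lemma centralising_chief_factor_preimage:
  assumes j: "\<And>A B n. chief_factor G (carrier G) A B \<Longrightarrow> A \<subseteq> N j \<Longrightarrow> N n \<subseteq> B \<Longrightarrow>
      chief_factor G (f ` carrier G) A B"
    and AB: "chief_factor G (carrier G) A B" "A \<subseteq> N j" "N n \<subseteq> B"
    and cov: "covered_by_cosets G A B k"
  obtains A' B' n' where "chief_factor G (carrier G) A' B'" "A' \<subseteq> N j" "N n' \<subseteq> B'"
    "covered_by_cosets G A' B' k"
    "\<forall>x \<in> carrier G. centralises G (f x) A' B' \<longrightarrow> centralises G x A B"
proof -
  let ?C = "carrier G" and ?H = "f ` carrier G"
  interpret f: group_hom G G f
    using f_hom by unfold_locales
  have H: "subgroup ?H G" by (rule f.img_is_subgroup)
  have HC: "?H \<subseteq> ?C" using f_closed by auto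
  have inv: "A \<in> invariant_subgroups G ?C" "B \<in> invariant_subgroups G ?C" "B \<subset> A"
    using AB by (auto simp: chief_factor_def)
  note AD = invariant_subgroupsD[OF inv(1)] and BD = invariant_subgroupsD[OF inv(2)]
  define a where "a = f ` A"
  define b where "b = f ` B"
  have ab: "chief_factor G ?H a b"
    unfolding a_def b_def by (rule image_chief_factor[OF f_hom f_inj AB(1)])
  then have invab: "a \<in> invariant_subgroups G ?H" "b \<in> invariant_subgroups G ?H" "b \<subset> a"
    by (auto simp: chief_factor_def)
  note aD = invariant_subgroupsD[OF invab(1)] and bD = invariant_subgroupsD[OF invab(2)]
  obtain l where "N l \<subseteq> f ` N n" using f_open by blast
  then have "N l \<subseteq> b" using AB(3) by (auto simp: b_def)
  \<comment> \<open>The covering series must end inside \<open>b\<close> and inside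
    \<open>N j\<close>.\<close>
  define i where "i = max l j"
  have i: "N i \<subseteq> b" "N i \<subseteq> N j"
    using \<open>N l \<subseteq> b\<close> N_antimono[of l i] N_antimono[of j i] by (auto simp: i_def)
  have "a \<subseteq> N j" using AB(2) f_N[of j] by (auto simp: a_def)
  then obtain A' B' where A'B': "chief_factor G ?C A' B'" "A' \<subseteq> N j" "N i \<subseteq> B'"
    and cover: "\<not> A' \<inter> a \<subseteq> b" "B' \<inter> a \<subseteq> b"
    using obtain_covering_chief_factor[OF N_finite_overgroups[OF order_refl] N_invariant[of j]
        N_invariant[of i] i(2), of a b] i(1) invab(3) by blast
  have chiefH: "chief_factor G ?H A' B'" by (rule j[OF A'B'])
  then have inv': "A' \<in> invariant_subgroups G ?H" "B' \<in> invariant_subgroups G ?H" "B' \<subset> A'"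
    by (auto simp: chief_factor_def)
  note A'D = invariant_subgroupsD[OF inv'(1)] and B'D = invariant_subgroupsD[OF inv'(2)]
  have invA'a: "A' \<inter> a \<in> invariant_subgroups G ?H"
    and invA'b: "A' \<inter> b \<in> invariant_subgroups G ?H"
    using invariant_Int[OF inv'(1) _ order_refl] invab by auto
  \<comment> \<open>Containment in \<open>B'\<close> would put \<open>A' \<inter> a\<close> inside
    \<open>B' \<inter> a\<close>, hence inside \<open>b\<close>.\<close>
  have "\<not> A' \<inter> a \<subseteq> B'" using cover by auto
  then have A'_eq: "(A' \<inter> a) <#> B' = A'"
    by (intro chief_factor_eq_set_mult[OF H chiefH invA'a]) auto
  \<comment> \<open>Otherwise \<open>A' = (A' \<inter> b) B'\<close>, and the modular law would give
    \<open>A' \<inter> a \<subseteq> b\<close>. Thus elements of \<open>A' \<inter> a\<close> in one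
    coset of \<open>b\<close> also lie in one coset of \<open>B'\<close>.\<close>
  have b_int: "A' \<inter> b \<subseteq> B'"
  proof (rule ccontr)
    assume "\<not> A' \<inter> b \<subseteq> B'"
    then have eq: "(A' \<inter> b) <#> B' = A'"
      by (intro chief_factor_eq_set_mult[OF H chiefH invA'b]) auto
    have "A' \<inter> a \<subseteq> A' \<inter> b"
      using invab(3) cover(2) inv'(3) eq invariant_subgroupsD(1)[OF invA'a]
        invariant_subgroupsD(1)[OF invA'b] B'D(1)
      by (intro modular_law[of "A' \<inter> b" "A' \<inter> a" B']) auto
    then show False using cover(1) by auto
  qed
  have "covered_by_cosets G a b k"
    unfolding a_def b_def by (rule covered_by_cosets_image[OF f_hom BD(3) cov])
  then obtain F where F: "finite F" "card F \<le> k" "F \<subseteq> ?C" "a \<subseteq> (\<Union>g \<in> F. g <# b)"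
    by (auto simp: covered_by_cosets_def)
  \<comment> \<open>Only cosets of \<open>b\<close> meeting \<open>A' \<inter> a\<close> are kept,
    each represented by some \<open>r g\<close> in that intersection; these representatives also
    cover \<open>A'\<close> modulo \<open>B'\<close>.\<close>
  define F' where "F' = {g \<in> F. \<exists>z \<in> A' \<inter> a. z \<in> g <# b}"
  define r where "r g = (SOME z. z \<in> A' \<inter> a \<and> z \<in> g <# b)" for g
  have r: "r g \<in> A' \<inter> a \<and> r g \<in> g <# b" if "g \<in> F'" for g
  proof -
    have "\<exists>z. z \<in> A' \<inter> a \<and> z \<in> g <# b" using that by (auto simp: F'_def)
    then show ?thesis unfolding r_def by (rule someI_ex)
  qed
  have "y \<in> (\<Union>g \<in> r ` F'. g <# B')" if "y \<in> A'" for y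
  proof -
    have "y \<in> (A' \<inter> a) <#> B'" using that by (simp only: A'_eq)
    then obtain z w where zw: "z \<in> A' \<inter> a" "w \<in> B'" "y = z \<otimes> w"
      by (auto simp: set_mult_def)
    then obtain g where g: "g \<in> F" "z \<in> g <# b" using F(4) by blast
    then have gF: "g \<in> F'" using zw by (auto simp: F'_def)
    note rg = r[OF gF]
    obtain s t where st: "s \<in> b" "z = g \<otimes> s" "t \<in> b" "r g = g \<otimes> t"
      using g(2) rg by (auto simp: l_coset_def)
    have c: "g \<in> ?C" "s \<in> ?C" "t \<in> ?C" "w \<in> ?C" using g(1) F(3) st bD(3) zw(2) B'D(3) by auto
    have rc: "r g \<in> ?C" "z \<in> ?C" using st c by auto
    have "inv (r g) \<otimes> z = inv t \<otimes> s"
      using c by (simp add: st inv_mult_group m_assoc inv_cancel_left)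
    then have "inv (r g) \<otimes> z \<in> b" using st bD(5,6) by simp
    moreover have "inv (r g) \<otimes> z \<in> A'" using rg zw(1) A'D(5,6) by simp
    ultimately have "inv (r g) \<otimes> z \<in> B'" using b_int by auto
    then have "(inv (r g) \<otimes> z) \<otimes> w \<in> B'" using zw(2) B'D(5) by simp
    moreover have "y = r g \<otimes> ((inv (r g) \<otimes> z) \<otimes> w)"
      using rc c zw(3) by (simp add: m_assoc inv_cancel_left)
    ultimately have "y \<in> r g <# B'" unfolding l_coset_def by blast
    then show ?thesis using gF by blast
  qed
  moreover have "finite (r ` F')" "card (r ` F') \<le> k" "r ` F' \<subseteq> ?C"
  proof -
    have "F' \<subseteq> F" by (auto simp: F'_def)
    then have "finite F'" "card F' \<le> card F" using F(1) finite_subset card_mono by auto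
    then show "finite (r ` F')" "card (r ` F') \<le> k"
      using F(2) card_image_le[of F' r] by auto
    show "r ` F' \<subseteq> ?C" using r A'D(3) by auto
  qed
  ultimately have cov': "covered_by_cosets G A' B' k"
    unfolding covered_by_cosets_def by (intro exI[of _ "r ` F'"]) auto
  have "centralises G x A B" if x: "x \<in> ?C" and "centralises G (f x) A' B'" for x
  proof -
    have "centralises G (f x) a b"
      using x by (intro centralises_covered[OF H order_refl ab inv'(1) cover _ that(2)]) auto
    then show ?thesis
      unfolding a_def b_def by (rule image_centralises[OF f_hom f_inj AD(3) BD(3) x])
  qed
  then show ?thesis using that A'B' cov' by blast
qed

text \<open>Induction on \<open>i\<close>: the element moves to \<open>f x\<close> and the factor to
  the one supplied by the preimage lemma, while \<open>k\<close> stays fixed. At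
  \<open>i = 0\<close> the element lies in \<open>N k\<close>, which centralises every factor
  covered by \<open>k\<close> cosets.\<close>

lemma funpow_centralises_chief_factor:
  assumes j: "\<And>A B n. chief_factor G (carrier G) A B \<Longrightarrow> A \<subseteq> N j \<Longrightarrow> N n \<subseteq> B \<Longrightarrow>
      chief_factor G (f ` carrier G) A B"
  shows "x \<in> carrier G \<Longrightarrow> (f ^^ i) x \<in> N k \<Longrightarrow> chief_factor G (carrier G) A B \<Longrightarrow> A \<subseteq> N j \<Longrightarrow>
    N n \<subseteq> B \<Longrightarrow> covered_by_cosets G A B k \<Longrightarrow> centralises G x A B"
proof (induction i arbitrary: x A B n)
  case 0
  then show ?case
    by (intro centralises_covered_by_cosets[of A B n k]) (auto simp: chief_factor_def)
next
  case (Suc i)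
  obtain A' B' n' where "chief_factor G (carrier G) A' B'" "A' \<subseteq> N j" "N n' \<subseteq> B'"
    "covered_by_cosets G A' B' k"
    and *: "\<forall>x \<in> carrier G. centralises G (f x) A' B' \<longrightarrow> centralises G x A B"
    by (rule centralising_chief_factor_preimage[OF j Suc.prems(3-6)])
  then have "centralises G (f x) A' B'"
    using Suc.prems(1,2) by (intro Suc.IH[of "f x"] f_closed) (auto simp: funpow_swap1)
  then show ?case using * Suc.prems(1) by blast
qed

text \<open>The iterate \<open>g x\<close> lies in \<open>N j\<close> and so handles all chief
  factors of \<open>G\<close>, above and below \<open>N j\<close>. The factor
  \<open>g(A) / g(B)\<close> is covered by one of these, and \<open>g\<close> carries the conclusion
  back to \<open>x\<close>.\<close>

lemma contracted_centralises_chief_factor: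
  assumes x: "x \<in> carrier G" and con: "\<And>k. \<exists>i. (f ^^ i) x \<in> N k"
    and AB: "chief_factor G (carrier G) A B" "N n \<subseteq> B"
  shows "centralises G x A B"
proof -
  let ?C = "carrier G"
  obtain j where j: "\<And>A B n. chief_factor G ?C A B \<Longrightarrow> A \<subseteq> N j \<Longrightarrow> N n \<subseteq> B \<Longrightarrow>
      chief_factor G (f ` ?C) A B"
    using eventually_chief_factor_image by blast
  obtain i where i: "(f ^^ i) x \<in> N j" using con by blast
  define g where "g = f ^^ i"
  interpret g: filtered_group_endo G N g
    unfolding g_def by (rule funpow_filtered_group_endo)
  interpret gh: group_hom G G g
    using g.f_hom by unfold_locales
  have H: "subgroup (g ` ?C) G" by (rule gh.img_is_subgroup)
  have HC: "g ` ?C \<subseteq> ?C" using g.f_closed by auto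
  have gx: "g x \<in> ?C" "g x \<in> N j" using g.f_closed[OF x] i by (auto simp: g_def)
  \<comment> \<open>The iterates of \<open>g x\<close> are \<open>f^i\<close> applied to those of
    \<open>x\<close>, and \<open>f^i\<close> preserves \<open>N k\<close>.\<close>
  have con_gx: "\<exists>l. (f ^^ l) (g x) \<in> N k" for k
  proof -
    obtain l where "(f ^^ l) x \<in> N k" using con by blast
    then have "(f ^^ i) ((f ^^ l) x) \<in> N k"
      using filtered_group_endo.f_N[OF funpow_filtered_group_endo] by blast
    then show ?thesis unfolding g_def by (metis add.commute comp_apply funpow_add)
  qed
  have inv: "A \<in> invariant_subgroups G ?C" "B \<in> invariant_subgroups G ?C" "B \<subset> A"
    using AB by (auto simp: chief_factor_def)
  note AD = invariant_subgroupsD[OF inv(1)] and BD = invariant_subgroupsD[OF inv(2)]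
  have ab: "chief_factor G (g ` ?C) (g ` A) (g ` B)"
    by (rule image_chief_factor[OF g.f_hom g.f_inj AB(1)])
  obtain m where "N m \<subseteq> g ` N n" using g.f_open by blast
  then have m: "N m \<subseteq> g ` B" using AB(2) by blast
  have invC: "?C \<in> invariant_subgroups G ?C"
    using subgroup_self by (auto simp: invariant_subgroups_def)
  have "g ` A \<subseteq> ?C" "N m \<inter> g ` A \<subseteq> g ` B" "\<not> g ` A \<subseteq> g ` B"
    using ab AD(3) HC m by (auto simp: chief_factor_def)
  then obtain A' B' where A'B': "chief_factor G ?C A' B'" "A' \<subseteq> ?C" "N m \<subseteq> B'"
    and cover: "\<not> A' \<inter> g ` A \<subseteq> g ` B" "B' \<inter> g ` A \<subseteq> g ` B"
    by (rule obtain_covering_chief_factor[OF N_finite_overgroups[OF order_refl] invC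
        N_invariant[of m] N_subset, of "g ` A" "g ` B"])
  have inv': "A' \<in> invariant_subgroups G ?C" "B' \<in> invariant_subgroups G ?C" "B' \<subset> A'"
    using A'B' by (auto simp: chief_factor_def)
  note A'D = invariant_subgroupsD[OF inv'(1)] and B'D = invariant_subgroupsD[OF inv'(2)]
    and ND = invariant_subgroupsD[OF N_invariant[of j]]
  define A1 where "A1 = A' \<inter> N j"
  define B1 where "B1 = B' \<inter> N j"
  have inv1: "A1 \<in> invariant_subgroups G ?C" "B1 \<in> invariant_subgroups G ?C"
    unfolding A1_def B1_def by (auto intro: invariant_Int inv' N_invariant)
  have "centralises G (g x) A' B'"
  proof (cases "A1 \<subseteq> B'")
    \<comment> \<open>The factor lies above \<open>N j\<close>: commutators of \<open>g x\<close>
      with \<open>A'\<close> fall into \<open>A' \<inter> N j\<close>, which is inside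
      \<open>B'\<close>.\<close>
    case True
    have "g x \<otimes> y \<otimes> inv (g x) \<otimes> inv y \<in> B'" if y: "y \<in> A'" for y
    proof -
      have yc: "y \<in> ?C" using y A'D(3) by auto
      have "g x \<otimes> y \<otimes> inv (g x) \<otimes> inv y \<in> A'" using y A'D(5-7) gx by blast
      moreover have "g x \<otimes> (y \<otimes> inv (g x) \<otimes> inv y) \<in> N j" using yc ND(5-7) gx by blast
      then have "g x \<otimes> y \<otimes> inv (g x) \<otimes> inv y \<in> N j" using gx(1) yc by (simp add: m_assoc)
      ultimately show ?thesis using True by (auto simp: A1_def)
    qed
    then show ?thesis by (simp add: centralises_def)
  next
    case False
    \<comment> \<open>Here \<open>A' / B'\<close> is isomorphic to \<open>A1 / B1\<close>, a chief
      factor below \<open>N j\<close>, to which the iteration applies.\<close>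
    have eq: "A1 <#> B' = A'"
      using False by (intro chief_factor_eq_set_mult[OF subgroup_self A'B'(1) inv1(1)])
        (auto simp: A1_def)
    have "chief_factor G ?C A1 B1"
      unfolding chief_factor_def
    proof (intro conjI ballI impI)
      show "B1 \<subset> A1" using False inv'(3) by (auto simp: A1_def B1_def)
      fix X assume X: "X \<in> invariant_subgroups G ?C" "B1 \<subseteq> X \<and> X \<subseteq> A1"
      show "X = B1 \<or> X = A1"
      proof (cases "X \<subseteq> B'")
        case True
        then show ?thesis using X by (auto simp: A1_def B1_def)
      next
        case nle: False
        have "X <#> B' = A'"
          using X nle by (intro chief_factor_eq_set_mult[OF subgroup_self A'B'(1) X(1)])
            (auto simp: A1_def)
        then have "A1 \<subseteq> X"
          using X invariant_subgroupsD(1)[OF X(1)] invariant_subgroupsD(1)[OF inv1(1)] B'D(1)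
          by (intro modular_law[of X A1 B']) (auto simp: A1_def B1_def)
        then show ?thesis using X by auto
      qed
    qed (fact inv1)+
    moreover define l where "l = max m j"
    have l: "N l \<subseteq> B1"
      using A'B'(3) N_antimono[of m l] N_antimono[of j l] by (auto simp: B1_def l_def)
    \<comment> \<open>Some bound for \<open>A1 / B1\<close> suffices; the index of
      \<open>N l\<close> in \<open>G\<close> provides one.\<close>
    obtain k where "covered_by_cosets G ?C (N l) k"
      using covered_by_cosets_finite_index[OF N_invariant N_finite_index] by blast
    then have cov: "covered_by_cosets G A1 B1 k"
      by (rule covered_by_cosets_mono[OF _ invariant_subgroupsD(3)[OF inv1(1)] l])
    obtain p where "(f ^^ p) (g x) \<in> N k" using con_gx by blast
    ultimately have "centralises G (g x) A1 B1"
      using l cov gx(1)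
      by (intro funpow_centralises_chief_factor[OF j, where x = "g x" and i = p and k = k and n = l]) (auto simp: A1_def)
    then have "centralises G (g x) A1 B'" by (auto simp: centralises_def B1_def)
    then have "centralises G (g x) (A1 <#> B') B'"
      using centralises_set_mult[OF gx(1) invariant_subgroupsD(3)[OF inv1(1)] inv'(2) subgroup_self]
      by blast
    then show ?thesis by (simp add: eq)
  qed
  then have "centralises G (g x) (g ` A) (g ` B)"
    using x by (intro centralises_covered[OF H HC ab inv'(1) cover]) auto
  then show ?thesis by (rule image_centralises[OF g.f_hom g.f_inj AD(3) BD(3) x])
qed

end

section \<open>Lower central series\<close>

lemma lower_central_series_subset:
  assumes "group G"
  shows "lower_central_series G n \<subseteq> carrier G"
proof (induction n)
  case (Suc n)
  interpret group G by (rule assms)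
  show ?case
    unfolding lower_central_series.simps by (rule generate_incl) (use Suc.IH in auto)
qed simp

lemma (in group_hom) lower_central_series_image:
  assumes surj: "h ` carrier G = carrier H"
  shows "lower_central_series H n = h ` lower_central_series G n"
proof (induction n)
  case 0
  then show ?case using surj by simp
next
  case (Suc n)
  let ?L = "lower_central_series G n"
  note L = lower_central_series_subset[OF G.group_axioms, of n]
  have eq: "h (x \<otimes> y \<otimes> inv x \<otimes> inv y) = h x \<otimes>\<^bsub>H\<^esub> h y \<otimes>\<^bsub>H\<^esub> inv\<^bsub>H\<^esub> h x \<otimes>\<^bsub>H\<^esub> inv\<^bsub>H\<^esub> h y"
    if "x \<in> ?L" "y \<in> carrier G" for x y
  proof -
    have "x \<in> carrier G" using that(1) L by auto
    then show ?thesis using that(2) by simp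
  qed
  have "{x \<otimes>\<^bsub>H\<^esub> y \<otimes>\<^bsub>H\<^esub> inv\<^bsub>H\<^esub> x \<otimes>\<^bsub>H\<^esub> inv\<^bsub>H\<^esub> y | x y. x \<in> h ` ?L \<and> y \<in> h ` carrier G}
      = h ` {x \<otimes> y \<otimes> inv x \<otimes> inv y | x y. x \<in> ?L \<and> y \<in> carrier G}" (is "?l = h ` ?r")
  proof
    show "?l \<subseteq> h ` ?r"
    proof
      fix z assume "z \<in> ?l"
      then obtain x y where "x \<in> ?L" "y \<in> carrier G"
        "z = h x \<otimes>\<^bsub>H\<^esub> h y \<otimes>\<^bsub>H\<^esub> inv\<^bsub>H\<^esub> h x \<otimes>\<^bsub>H\<^esub> inv\<^bsub>H\<^esub> h y" by blast
      then have "z = h (x \<otimes> y \<otimes> inv x \<otimes> inv y)" using eq by simp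
      then show "z \<in> h ` ?r" using \<open>x \<in> ?L\<close> \<open>y \<in> carrier G\<close> by blast
    qed
    show "h ` ?r \<subseteq> ?l"
    proof
      fix z assume "z \<in> h ` ?r"
      then obtain x y where "x \<in> ?L" "y \<in> carrier G" "z = h (x \<otimes> y \<otimes> inv x \<otimes> inv y)" by blast
      then show "z \<in> ?l" using eq by blast
    qed
  qed
  moreover have "?r \<subseteq> carrier G" using L by auto
  ultimately show ?case using Suc.IH surj generate_img by simp
qed

lemma (in normal) nilpotent_FactGroup:
  assumes "lower_central_series G n \<subseteq> H"
  shows "nilpotent_group (G Mod H)"
proof -
  interpret Q: group "G Mod H" by (rule factorgroup_is_group)
  interpret q: group_hom G "G Mod H" "\<lambda>a. H #> a"
    using r_coset_hom_Mod by unfold_locales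
  have "lower_central_series (G Mod H) n = (\<lambda>a. H #> a) ` lower_central_series G n"
    by (rule q.lower_central_series_image) (simp add: carrier_FactGroup)
  also have "\<dots> \<subseteq> {H}"
    using assms coset_join2[OF _ subgroup_axioms] subset by auto
  finally have "lower_central_series (G Mod H) n \<subseteq> {\<one>\<^bsub>G Mod H\<^esub>}" by simp
  \<comment> \<open>The numbering starts with the whole group, so the identity is found in the
    carrier for \<open>n = 0\<close> and by \<open>generate.one\<close> otherwise.\<close>
  moreover have "\<one>\<^bsub>G Mod H\<^esub> \<in> lower_central_series (G Mod H) n"
    using Q.one_closed generate.one[of "G Mod H"] by (cases n) (simp_all del: one_FactGroup)
  ultimately show ?thesis unfolding nilpotent_group_def using Q.group_axioms by blast
qed

text \<open>Take \<open>A\<close> minimal among the normal subgroups of \<open>G\<close> above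
  \<open>N n\<close> that contain some term of the series of \<open>K\<close>. If \<open>A\<close>
  were larger than \<open>N n\<close>, a chief factor \<open>A / B\<close> centralised by
  \<open>K\<close> would put the next term into \<open>B\<close>.\<close>

lemma (in filtered_group) lower_central_series_le:
  assumes O: "subgroup K G"
    and cent: "\<And>x A B n. x \<in> K \<Longrightarrow> chief_factor G (carrier G) A B \<Longrightarrow> N n \<subseteq> B \<Longrightarrow>
      centralises G x A B"
  shows "\<exists>r. lower_central_series (G\<lparr>carrier := K\<rparr>) r \<subseteq> N n"
proof -
  let ?L = "lower_central_series (G\<lparr>carrier := K\<rparr>)"
  let ?I = "invariant_subgroups G (carrier G)"
  have L: "?L r \<subseteq> K" for r
    using lower_central_series_subset[OF subgroup.subgroup_is_group[OF O group_axioms], of r] by simp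
  have Kc: "K \<subseteq> carrier G" using O by (rule subgroup.subset)
  define S where "S = {X \<in> ?I. N n \<subseteq> X \<and> (\<exists>r. ?L r \<subseteq> X)}"
  have "carrier G \<in> S"
    using subgroup_self N_subset Kc
    by (auto simp: S_def invariant_subgroups_def intro!: exI[of _ 0])
  moreover have fin: "finite_overgroups G (N n)" by (rule N_finite_overgroups[OF order_refl])
  then have "finite S"
    unfolding S_def by (rule finite_invariant_interval)
  ultimately obtain A where A: "A \<in> S" "\<And>X. X \<in> S \<Longrightarrow> X \<subseteq> A \<Longrightarrow> X = A"
    using finite_has_minimal[of S] by (metis empty_iff)
  obtain r where r: "?L r \<subseteq> A" using A(1) by (auto simp: S_def)
  have "A = N n"
  proof (rule ccontr)
    assume "A \<noteq> N n"
    then have "N n \<subset> A" "A \<in> ?I" using A(1) by (auto simp: S_def)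
    then obtain B where B: "chief_factor G (carrier G) A B" "N n \<subseteq> B"
      using obtain_chief_factor_below[OF fin _ N_invariant] by metis
    then have BI: "B \<in> ?I" "B \<subset> A" by (auto simp: chief_factor_def)
    note BD = invariant_subgroupsD[OF BI(1)]
    \<comment> \<open>The hypothesis concerns \<open>[y, x]\<close>, with \<open>y\<close> acting;
      its inverse is the commutator \<open>[x, y]\<close> of the series.\<close>
    have com: "x \<otimes> y \<otimes> inv x \<otimes> inv y \<in> B" if xy: "x \<in> ?L r" "y \<in> K" for x y
    proof -
      have "y \<otimes> x \<otimes> inv y \<otimes> inv x \<in> B"
        using cent[OF xy(2) B] xy(1) r by (auto simp: centralises_def)
      then have "inv (y \<otimes> x \<otimes> inv y \<otimes> inv x) \<in> B" by (rule BD(6))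
      moreover have "x \<in> carrier G" "y \<in> carrier G" using xy L Kc by auto
      ultimately show ?thesis by (simp add: inv_mult_group m_assoc)
    qed
    let ?C = "{x \<otimes> y \<otimes> inv x \<otimes> inv y | x y. x \<in> ?L r \<and> y \<in> K}"
    have "{x \<otimes> y \<otimes> inv\<^bsub>G\<lparr>carrier := K\<rparr>\<^esub> x \<otimes> inv\<^bsub>G\<lparr>carrier := K\<rparr>\<^esub> y | x y. x \<in> ?L r \<and> y \<in> K} = ?C"
    proof -
      have "inv\<^bsub>G\<lparr>carrier := K\<rparr>\<^esub> x = inv x" if "x \<in> K" for x
        using m_inv_consistent[OF O that] .
      moreover have "x \<in> K" if "x \<in> ?L r" for x using L that by auto
      ultimately show ?thesis by (intro Collect_cong ex_cong1) auto
    qed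
    then have "?L (Suc r) = generate (G\<lparr>carrier := K\<rparr>) ?C" by simp
    \<comment> \<open>Generation inside \<open>K\<close> agrees with generation in \<open>G\<close>,
      so \<open>B\<close> can be compared with the series.\<close>
    also have "\<dots> = generate G ?C"
    proof (rule generate_consistent[OF _ O])
      show "?C \<subseteq> K"
      proof
        fix z assume "z \<in> ?C"
        then obtain x y where "x \<in> ?L r" "y \<in> K" "z = x \<otimes> y \<otimes> inv x \<otimes> inv y" by blast
        then show "z \<in> K"
          using L[of r] subgroup.m_closed[OF O] subgroup.m_inv_closed[OF O] by auto
      qed
    qed
    also have "\<dots> \<subseteq> B" using com by (intro generate_subgroup_incl[OF _ BD(1)]) auto
    finally have "B \<in> S" using BI(1) B(2) unfolding S_def by blast
    then show False using A(2) BI(2) by blast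
  qed
  then show ?thesis using r by auto
qed

section \<open>Profinite groups\<close>

lemma topological_group_subgroup:
  assumes T: "topological_group G T" and K: "subgroup K G"
  shows "topological_group (G\<lparr>carrier := K\<rparr>) (subtopology T K)"
  unfolding topological_group_def
proof (intro conjI)
  interpret group G using T by (simp add: topological_group_def)
  have top: "topspace T = carrier G"
    and mult: "continuous_map (prod_topology T T) T (\<lambda>(x, y). x \<otimes>\<^bsub>G\<^esub> y)"
    and inv: "continuous_map T T (\<lambda>x. inv\<^bsub>G\<^esub> x)"
    using T by (auto simp: topological_group_def)
  show "group (G\<lparr>carrier := K\<rparr>)" by (rule subgroup.subgroup_is_group[OF K group_axioms])
  show "topspace (subtopology T K) = carrier (G\<lparr>carrier := K\<rparr>)"
    using subgroup.subset[OF K] top by auto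
  have "continuous_map (subtopology (prod_topology T T) (K \<times> K)) T (\<lambda>(x, y). x \<otimes>\<^bsub>G\<^esub> y)"
    using mult by (rule continuous_map_from_subtopology)
  then show "continuous_map (prod_topology (subtopology T K) (subtopology T K)) (subtopology T K)
      (\<lambda>(x, y). x \<otimes>\<^bsub>G\<lparr>carrier := K\<rparr>\<^esub> y)"
    unfolding subtopology_Times[symmetric] using subgroup.m_closed[OF K]
    by (auto simp: continuous_map_in_subtopology)
  have "continuous_map (subtopology T K) (subtopology T K) (\<lambda>x. inv\<^bsub>G\<^esub> x)"
    using continuous_map_from_subtopology[OF inv] subgroup.m_inv_closed[OF K]
    by (auto simp: continuous_map_in_subtopology)
  then show "continuous_map (subtopology T K) (subtopology T K) (\<lambda>x. inv\<^bsub>G\<lparr>carrier := K\<rparr>\<^esub> x)"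
    by (rule continuous_map_eq) (use m_inv_consistent[OF K] in auto)
qed

lemma totally_disconnected_subtopology:
  assumes "totally_disconnected_space T"
  shows "totally_disconnected_space (subtopology T S)"
  unfolding totally_disconnected_space_def
proof
  fix x assume x: "x \<in> topspace (subtopology T S)"
  have "connected_component_of (subtopology T S) x y \<Longrightarrow> connected_component_of T x y" for y
    unfolding connected_component_of_def by (auto simp: connectedin_subtopology)
  then have "connected_component_of_set (subtopology T S) x \<subseteq> {x}"
    using assms x by (auto simp: totally_disconnected_space_def)
  then show "connected_component_of_set (subtopology T S) x = {x}"
    using x by (auto simp: connected_component_of_refl)
qed

lemma profinite_group_closed_subgroup:
  assumes "profinite_group G T" "subgroup K G" "closedin T K"
  shows "profinite_group (G\<lparr>carrier := K\<rparr>) (subtopology T K)"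
  using assms topological_group_subgroup totally_disconnected_subtopology
  by (auto simp: profinite_group_def compact_space_subtopology closedin_compact_space
      Hausdorff_space_subtopology)

section \<open>Cosets and open subgroups of a profinite group\<close>

locale profinite = group G for G (structure) +
  fixes T :: "'a topology"
  assumes profinite: "profinite_group G T"
begin

lemma topspace_eq [simp]: "topspace T = carrier G"
  and continuous_mult: "continuous_map (prod_topology T T) T (\<lambda>(x, y). x \<otimes> y)"
  and compact_T: "compact_space T"
  and Hausdorff_T: "Hausdorff_space T"
  and totally_disconnected_T: "totally_disconnected_space T"
  using profinite by (auto simp: profinite_group_def topological_group_def)

lemma continuous_mult_left: "a \<in> carrier G \<Longrightarrow> continuous_map T T (\<lambda>x. a \<otimes> x)"
  using continuous_map_compose[OF _ continuous_mult, of T "\<lambda>x. (a, x)"]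
  by (simp add: continuous_map_pairedI comp_def)

lemma continuous_mult_right: "a \<in> carrier G \<Longrightarrow> continuous_map T T (\<lambda>x. x \<otimes> a)"
  using continuous_map_compose[OF _ continuous_mult, of T "\<lambda>x. (x, a)"]
  by (simp add: continuous_map_pairedI comp_def)

lemma openin_subset_carrier: "openin T U \<Longrightarrow> U \<subseteq> carrier G"
  using openin_subset by fastforce

lemma openin_l_coset:
  assumes "a \<in> carrier G" "openin T U"
  shows "openin T (a <# U)"
proof -
  have U: "U \<subseteq> carrier G" using assms(2) by (rule openin_subset_carrier)
  have "a <# U = {x \<in> topspace T. inv a \<otimes> x \<in> U}"
  proof
    show "a <# U \<subseteq> {x \<in> topspace T. inv a \<otimes> x \<in> U}"
      using U assms(1) by (auto simp: l_coset_def inv_cancel_left subset_iff)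
    show "{x \<in> topspace T. inv a \<otimes> x \<in> U} \<subseteq> a <# U"
    proof
      fix x assume x: "x \<in> {x \<in> topspace T. inv a \<otimes> x \<in> U}"
      then have "x = a \<otimes> (inv a \<otimes> x)" using assms(1) by (simp add: inv_cancel_left)
      then show "x \<in> a <# U" using x unfolding l_coset_def by blast
    qed
  qed
  then show ?thesis
    using continuous_mult_left[of "inv a"] assms by (auto simp: continuous_map_def)
qed

lemma openin_r_coset:
  assumes "a \<in> carrier G" "openin T U"
  shows "openin T (U #> a)"
proof -
  have U: "U \<subseteq> carrier G" using assms(2) by (rule openin_subset_carrier)
  have "U #> a = {x \<in> topspace T. x \<otimes> inv a \<in> U}"
  proof
    show "U #> a \<subseteq> {x \<in> topspace T. x \<otimes> inv a \<in> U}"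
      using U assms(1) by (auto simp: r_coset_def m_assoc subset_iff)
    show "{x \<in> topspace T. x \<otimes> inv a \<in> U} \<subseteq> U #> a"
    proof
      fix x assume x: "x \<in> {x \<in> topspace T. x \<otimes> inv a \<in> U}"
      then have "x = (x \<otimes> inv a) \<otimes> a" using assms(1) by (simp add: m_assoc)
      then show "x \<in> U #> a" using x unfolding r_coset_def by blast
    qed
  qed
  then show ?thesis
    using continuous_mult_right[of "inv a"] assms by (auto simp: continuous_map_def)
qed

lemma openin_subgroup:
  assumes S: "subgroup S G" and "openin T U" "\<one> \<in> U" "U \<subseteq> S"
  shows "openin T S"
proof -
  have "S = (\<Union>s \<in> S. s <# U)"
  proof
    show "S \<subseteq> (\<Union>s \<in> S. s <# U)"
    proof
      fix s assume s: "s \<in> S"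
      then have "s = s \<otimes> \<one>" using subgroup.mem_carrier[OF S] by simp
      then have "s \<in> s <# U" using assms(3) unfolding l_coset_def by blast
      then show "s \<in> (\<Union>s \<in> S. s <# U)" using s by blast
    qed
    show "(\<Union>s \<in> S. s <# U) \<subseteq> S"
      using assms(4) subgroup.m_closed[OF S] by (auto simp: l_coset_def)
  qed
  moreover have "openin T (\<Union>s \<in> S. s <# U)"
    using openin_l_coset[OF subgroup.mem_carrier[OF S] assms(2)] by blast
  ultimately show ?thesis by simp
qed

lemma closedin_union_cosets:
  assumes S: "subgroup S G" "openin T S" and "C \<subseteq> rcosets S"
  shows "closedin T (\<Union>C)"
proof -
  have "carrier G - \<Union>C = \<Union>(rcosets S - C)"
  proof
    show "carrier G - \<Union>C \<subseteq> \<Union>(rcosets S - C)" using rcosets_part_G[OF S(1)] by blast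
    have "\<Union>(rcosets S - C) \<inter> \<Union>C = {}"
    proof (rule ccontr)
      assume "\<Union>(rcosets S - C) \<inter> \<Union>C \<noteq> {}"
      then obtain x D E where "D \<in> rcosets S - C" "E \<in> C" "x \<in> D" "x \<in> E" by blast
      then have "D \<noteq> E" "D \<in> rcosets S" "E \<in> rcosets S" "\<not> disjnt D E"
        using assms(3) by (auto simp: disjnt_iff)
      then show False using rcos_disjoint[OF S(1)] by (simp add: pairwise_def)
    qed
    then show "\<Union>(rcosets S - C) \<subseteq> carrier G - \<Union>C"
      using rcosets_part_G[OF S(1)] by blast
  qed
  moreover have "openin T (\<Union>(rcosets S - C))"
    using openin_r_coset[OF _ S(2)] by (intro openin_Union) (auto simp: RCOSETS_def)
  moreover have "\<Union>C \<subseteq> carrier G" using rcosets_part_G[OF S(1)] assms(3) by blast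
  ultimately show ?thesis by (simp add: closedin_def)
qed

lemma closedin_open_subgroup:
  assumes "subgroup S G" "openin T S"
  shows "closedin T S"
  using closedin_union_cosets[OF assms, of "{S}"] subgroup.subgroup_in_rcosets[OF assms(1) group_axioms]
  by simp

text \<open>The cosets form a disjoint open cover by nonempty sets, so a finite subcover already
  contains all of them.\<close>

lemma finite_rcosets_open:
  assumes S: "subgroup S G" "openin T S"
  shows "finite (rcosets S)"
proof -
  have "\<forall>U \<in> rcosets S. openin T U" using openin_r_coset[OF _ S(2)] by (auto simp: RCOSETS_def)
  moreover have "topspace T \<subseteq> \<Union>(rcosets S)" using rcosets_part_G[OF S(1)] by simp
  ultimately obtain F where F: "finite F" "F \<subseteq> rcosets S" "topspace T \<subseteq> \<Union>F"
    using compact_T unfolding compact_space_alt by metis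
  have "rcosets S \<subseteq> F"
  proof
    fix C assume C: "C \<in> rcosets S"
    then obtain a where a: "a \<in> carrier G" "C = S #> a" by (auto simp: RCOSETS_def)
    then have "a \<in> C" using rcos_self[OF _ S(1)] by simp
    moreover obtain D where "D \<in> F" "a \<in> D" using F(3) a(1) by auto
    ultimately have "C = D"
      using rcos_disjoint[OF S(1)] C F(2) by (auto simp: pairwise_def disjnt_iff)
    then show "C \<in> F" using \<open>D \<in> F\<close> by simp
  qed
  then show ?thesis using F(1) finite_subset by blast
qed

text \<open>A clopen neighbourhood \<open>U\<close> of the identity inside \<open>W\<close> is
  stable under right multiplication by a small neighbourhood, hence by the subgroup this generates.
  Applied to the identity, this puts the subgroup inside \<open>U\<close>.\<close>

lemma obtain_open_subgroup:
  assumes "openin T W" "\<one> \<in> W"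
  obtains S where "subgroup S G" "openin T S" "S \<subseteq> W"
proof -
  have "connected_component_of_set T \<one> = {\<one>}"
    using totally_disconnected_T by (simp add: totally_disconnected_space_def)
  then have "{\<one>} \<in> connected_components_of T"
    by (metis connected_components_of_def image_eqI one_closed topspace_eq)
  moreover have "closedin T (topspace T - W)" using assms(1) by blast
  \<comment> \<open>In a compact Hausdorff space a clopen set separates the component
    \<open>{\<one>}\<close> from the closed complement of \<open>W\<close>.\<close>
  ultimately have "separated_between T {\<one>} (topspace T - W)"
    using assms(2) Hausdorff_T compact_T
    by (intro separated_between_compact_connected_component)
      (auto simp: compact_imp_locally_compact_space)
  then obtain U where U: "closedin T U" "openin T U" "\<one> \<in> U" "topspace T - W \<subseteq> topspace T - U"
    unfolding separated_between by auto
  have UW: "U \<subseteq> W" using U(4) openin_subset[OF U(2)] by auto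
  have Uc: "U \<subseteq> carrier G" using openin_subset[OF U(2)] by simp
  let ?P = "{z \<in> topspace (prod_topology T T). (\<lambda>(x, y). x \<otimes> y) z \<in> U}"
  have "openin (prod_topology T T) ?P"
    using continuous_mult U(2) by (rule openin_continuous_map_preimage)
  moreover have "compactin T U" using U(1) compact_T by (rule closedin_compact_space[rotated])
  moreover have "U \<times> {\<one>} \<subseteq> ?P" using Uc by auto
  \<comment> \<open>The tube lemma turns the compact slice \<open>U \<times> {\<one>}\<close> into
    one \<open>V\<close> that works for all of \<open>U\<close>.\<close>
  ultimately obtain V1 V where V: "openin T V" "U \<subseteq> V1" "\<one> \<in> V" "V1 \<times> V \<subseteq> ?P"
    using tube_lemma_left[of T T ?P U \<one>] by auto
  have UV: "u \<otimes> v \<in> U" if "u \<in> U" "v \<in> V" for u v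
  proof -
    have "(u, v) \<in> V1 \<times> V" using that V(2) by auto
    then have "(u, v) \<in> ?P" using V(4) by (rule subsetD[rotated])
    then show ?thesis by simp
  qed
  have Vc: "V \<subseteq> carrier G" using openin_subset[OF V(1)] by simp
  \<comment> \<open>Symmetrised so that inverses of generators also lie in \<open>V\<close>.\<close>
  define V' where "V' = {x \<in> topspace T. inv x \<in> V} \<inter> V"
  have "continuous_map T T (\<lambda>x. inv x)"
    using profinite by (simp add: profinite_group_def topological_group_def)
  then have V'o: "openin T V'"
    unfolding V'_def using V(1) by (intro openin_Int openin_continuous_map_preimage)
  have V'1: "\<one> \<in> V'" "V' \<subseteq> carrier G" using V(3) by (auto simp: V'_def)
  have right: "u \<otimes> v \<in> U" if "v \<in> generate G V'" "u \<in> U" for u v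
    using that
  proof (induction v arbitrary: u rule: generate.induct)
    case one
    then show ?case using Uc by auto
  next
    case (incl h)
    then show ?case using UV by (simp add: V'_def)
  next
    case (inv h)
    then show ?case using UV by (simp add: V'_def)
  next
    case (eng h1 h2)
    then have "u \<otimes> h1 \<otimes> h2 \<in> U" by blast
    moreover have "h1 \<in> carrier G" "h2 \<in> carrier G" "u \<in> carrier G"
      using eng.hyps generate_in_carrier[OF V'1(2)] eng.prems Uc by auto
    ultimately show ?case by (simp add: m_assoc)
  qed
  have "subgroup (generate G V') G" by (rule generate_is_subgroup[OF V'1(2)])
  moreover have "openin T (generate G V')"
    by (rule openin_subgroup[OF calculation V'o V'1(1)]) (auto intro: generate.incl)
  moreover have "generate G V' \<subseteq> W"
  proof
    fix v assume v: "v \<in> generate G V'"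
    then have "\<one> \<otimes> v \<in> U" using right U(3) by blast
    then show "v \<in> W" using generate_in_carrier[OF V'1(2) v] UW by auto
  qed
  ultimately show ?thesis by (rule that)
qed

end

section \<open>Profinite groups of type (F)\<close>

text \<open>The intersection with the carrier matters only for \<open>k = 0\<close>, where the family is empty.\<close>

definition bounded_index_core :: "('a, 'b) monoid_scheme \<Rightarrow> 'a topology \<Rightarrow> nat \<Rightarrow> 'a set" where
  "bounded_index_core G T k =
     carrier G \<inter> \<Inter>{U. subgroup U G \<and> openin T U \<and> card (rcosets\<^bsub>G\<^esub> U) \<le> k}"

text \<open>The coset of \<open>x\<close> is sent to \<open>U \<phi>(x)\<close>, which is injective.
  Finiteness matters because \<open>card\<close> of an infinite set is 0.\<close>

lemma (in group) card_rcosets_preimage_le: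
  assumes \<phi>: "\<phi> \<in> hom G G" and U: "subgroup U G" and fin: "finite (rcosets U)"
  shows "card (rcosets {x \<in> carrier G. \<phi> x \<in> U}) \<le> card (rcosets U)"
proof -
  interpret \<phi>: group_hom G G \<phi>
    using \<phi> by unfold_locales
  let ?S = "{x \<in> carrier G. \<phi> x \<in> U}"
  have S: "subgroup ?S G"
    using subgroup.one_closed[OF U] subgroup.m_closed[OF U] subgroup.m_inv_closed[OF U]
    by (intro subgroupI) auto
  define r where "r C = (SOME x. x \<in> carrier G \<and> C = ?S #> x)" for C
  have r: "r C \<in> carrier G \<and> C = ?S #> r C" if "C \<in> rcosets ?S" for C
    unfolding r_def by (rule someI_ex) (use that in \<open>auto simp: RCOSETS_def\<close>)
  have "inj_on (\<lambda>C. U #> \<phi> (r C)) (rcosets ?S)"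
  proof (rule inj_onI)
    fix C D assume C: "C \<in> rcosets ?S" and D: "D \<in> rcosets ?S"
      and eq: "U #> \<phi> (r C) = U #> \<phi> (r D)"
    have x: "r C \<in> carrier G" and y: "r D \<in> carrier G" using r C D by auto
    have "\<phi> (r D) \<in> U #> \<phi> (r C)" using eq rcos_self[OF _ U] y by simp
    then obtain u where u: "u \<in> U" "\<phi> (r D) = u \<otimes> \<phi> (r C)" by (auto simp: r_coset_def)
    then have "u = \<phi> (r D \<otimes> inv (r C))"
      using x y subgroup.mem_carrier[OF U] by (simp add: m_assoc)
    then have "r D \<otimes> inv (r C) \<in> ?S" using u(1) x y by simp
    moreover have "r D = (r D \<otimes> inv (r C)) \<otimes> r C" using x y by (simp add: m_assoc)
    ultimately have "r D \<in> ?S #> r C" unfolding r_coset_def by blast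
    then have "?S #> r C = ?S #> r D" by (rule repr_independence[OF _ x S])
    moreover have "C = ?S #> r C" "D = ?S #> r D" using r[OF C] r[OF D] by blast+
    ultimately show "C = D" by argo
  qed
  moreover have "(\<lambda>C. U #> \<phi> (r C)) ` (rcosets ?S) \<subseteq> rcosets U"
    using r by (auto intro!: rcosetsI subgroup.subset[OF U])
  ultimately show ?thesis using fin by (intro card_inj_on_le) auto
qed

section \<open>The filtration by subgroups of bounded index\<close>

locale profinite_type_F = profinite +
  assumes type_F: "type_F G T"
begin

abbreviation "core \<equiv> bounded_index_core G T"

lemma core_subset: "core k \<subseteq> carrier G"
  by (auto simp: bounded_index_core_def)

lemma core_least:
  assumes "subgroup U G" "openin T U" "card (rcosets U) \<le> k"
  shows "core k \<subseteq> U"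
  using assms by (auto simp: bounded_index_core_def)

lemma core_antimono: "m \<le> n \<Longrightarrow> core n \<subseteq> core m"
  by (auto simp: bounded_index_core_def)

lemma openin_preimage_subgroup:
  assumes "\<phi> \<in> hom G G" "continuous_map T T \<phi>" "subgroup U G" "openin T U"
  shows "subgroup {x \<in> carrier G. \<phi> x \<in> U} G" "openin T {x \<in> carrier G. \<phi> x \<in> U}"
proof -
  interpret \<phi>: group_hom G G \<phi>
    using assms(1) by unfold_locales
  show "subgroup {x \<in> carrier G. \<phi> x \<in> U} G"
    using subgroup.one_closed[OF assms(3)] subgroup.m_closed[OF assms(3)]
      subgroup.m_inv_closed[OF assms(3)]
    by (intro subgroupI) auto
  show "openin T {x \<in> carrier G. \<phi> x \<in> U}"
    using openin_continuous_map_preimage[OF assms(2,4)] by simp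
qed

text \<open>Preimages of the open subgroups defining \<open>core k\<close> are among those subgroups
  again. The lemma serves both \<open>End_o\<close> and inner automorphisms.\<close>

lemma core_endomorphism:
  assumes "\<phi> \<in> hom G G" "continuous_map T T \<phi>" "x \<in> core k"
  shows "\<phi> x \<in> core k"
  unfolding bounded_index_core_def
proof (intro IntI InterI)
  have xc: "x \<in> carrier G" using assms(3) core_subset by auto
  then show "\<phi> x \<in> carrier G" using assms(1) by (auto simp: hom_def)
  fix U assume "U \<in> {U. subgroup U G \<and> openin T U \<and> card (rcosets U) \<le> k}"
  then have U: "subgroup U G" "openin T U" "card (rcosets U) \<le> k" by auto
  have "core k \<subseteq> {x \<in> carrier G. \<phi> x \<in> U}"
    using card_rcosets_preimage_le[OF assms(1) U(1) finite_rcosets_open[OF U(1,2)]] U(3)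
    by (intro core_least openin_preimage_subgroup[OF assms(1,2) U(1,2)]) simp
  then show "\<phi> x \<in> U" using assms(3) by auto
qed

lemma core_subgroup: "subgroup (core k) G"
proof -
  have "core k = \<Inter>(insert (carrier G) {U. subgroup U G \<and> openin T U \<and> card (rcosets U) \<le> k})"
    by (auto simp: bounded_index_core_def)
  then show ?thesis
    using subgroups_Inter[of "insert (carrier G) {U. subgroup U G \<and> openin T U \<and> card (rcosets U) \<le> k}"]
      subgroup_self by auto
qed

lemma core_invariant: "core k \<in> invariant_subgroups G (carrier G)"
proof -
  have "g \<otimes> x \<otimes> inv g \<in> core k" if g: "g \<in> carrier G" and x: "x \<in> core k" for g x
  proof (rule core_endomorphism[where \<phi> = "\<lambda>x. g \<otimes> x \<otimes> inv g", OF _ _ x])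
    show "(\<lambda>x. g \<otimes> x \<otimes> inv g) \<in> hom G G"
      using g by (intro homI) (auto simp: m_assoc inv_cancel_left)
    show "continuous_map T T (\<lambda>x. g \<otimes> x \<otimes> inv g)"
      using continuous_map_compose[OF continuous_mult_left[OF g] continuous_mult_right[of "inv g"]] g
      by (simp add: comp_def)
  qed
  then show ?thesis using core_subgroup core_subset by (auto simp: invariant_subgroups_def)
qed

lemma openin_core: "openin T (core k)"
proof -
  let ?F = "\<lambda>n. {U. subgroup U G \<and> openin T U \<and> card (rcosets U) = n}"
  \<comment> \<open>An open subgroup has finite index, so its recorded index is positive and type
    (F) applies to the range from 1 to \<open>k\<close>.\<close>
  have "card (rcosets U) \<noteq> 0" if "subgroup U G" "openin T U" for U
    using finite_rcosets_open[OF that] rcosetsI[OF subgroup.subset[OF that(1)] one_closed] by auto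
  then have "{U. subgroup U G \<and> openin T U \<and> card (rcosets U) \<le> k} \<subseteq> (\<Union>n \<in> {1..k}. ?F n)"
    by (auto simp: Suc_le_eq)
  moreover have "finite (\<Union>n \<in> {1..k}. ?F n)" using type_F by (auto simp: type_F_def)
  ultimately have "finite {U. subgroup U G \<and> openin T U \<and> card (rcosets U) \<le> k}"
    by (rule finite_subset)
  then have "openin T (\<Inter>(insert (carrier G) {U. subgroup U G \<and> openin T U \<and> card (rcosets U) \<le> k}))"
    using openin_topspace[of T] by (intro openin_Inter) auto
  moreover have "core k = \<Inter>(insert (carrier G) {U. subgroup U G \<and> openin T U \<and> card (rcosets U) \<le> k})"
    by (auto simp: bounded_index_core_def)
  ultimately show ?thesis by simp
qed

text \<open>The neighbourhood contains an open subgroup, and its index serves as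
  \<open>k\<close>.\<close>

lemma core_base:
  assumes "openin T W" "\<one> \<in> W"
  shows "\<exists>k. core k \<subseteq> W"
proof -
  obtain S where S: "subgroup S G" "openin T S" "S \<subseteq> W" by (rule obtain_open_subgroup[OF assms])
  then show ?thesis using core_least[OF S(1,2) order_refl] by blast
qed

lemma filtered: "filtered_group G core"
proof unfold_locales
  show "core n \<in> invariant_subgroups G (carrier G)" for n by (rule core_invariant)
  show "m \<le> n \<Longrightarrow> core n \<subseteq> core m" for m n by (rule core_antimono)
  show "finite (rcosets (core n))" for n by (rule finite_rcosets_open[OF core_subgroup openin_core])
  fix S n k assume S: "subgroup S G" "core n \<subseteq> S" "card (rcosets S) \<le> k"
  have "openin T S"
    using openin_subgroup[OF S(1) openin_core subgroup.one_closed[OF core_subgroup] S(2)] .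
  then show "core k \<subseteq> S" using core_least S by blast
qed

sublocale filtered_group G core
  by (rule filtered)

lemma End_o_filtered_group_endo:
  assumes f: "f \<in> End_o G T"
  shows "filtered_group_endo G core f"
proof unfold_locales
  have hom: "f \<in> hom G G" and cont: "continuous_map T T f" and inj: "inj_on f (carrier G)"
    and op: "openin T (f ` carrier G)"
    using f by (auto simp: End_o_def)
  show "f \<in> hom G G" "inj_on f (carrier G)" by (rule hom, rule inj)
  interpret f: group_hom G G f
    using hom by unfold_locales
  show "f ` core n \<subseteq> core n" for n using core_endomorphism[OF hom cont] by auto
  show "\<exists>m. core m \<subseteq> f ` core n" for n
  proof (rule core_base)
    \<comment> \<open>By compactness \<open>f\<close> is closed; by injectivity
      \<open>f(core n)\<close> is the open set \<open>f(G)\<close> minus the closed image of the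
      complement of \<open>core n\<close>.\<close>
    have "closed_map T T f"
      using continuous_imp_closed_map[OF cont compact_T Hausdorff_T] .
    moreover have "closedin T (topspace T - core n)" using openin_core by blast
    ultimately have "closedin T (f ` (carrier G - core n))" by (simp add: closed_map_def)
    then have "openin T (f ` carrier G - f ` (carrier G - core n))" using op by (rule openin_diff[rotated])
    moreover have "f ` carrier G - f ` (carrier G - core n) = f ` core n"
      using inj_on_image_set_diff[OF inj, of "carrier G" "carrier G - core n"] core_subset[of n]
      by (simp add: double_diff)
    ultimately show "openin T (f ` core n)" by simp
    show "\<one> \<in> f ` core n"
      using subgroup.one_closed[OF core_subgroup] f.hom_one by (metis image_eqI)
  qed
qed

section \<open>Contraction and closure in terms of the filtration\<close>

text \<open>Since \<open>f\<close> preserves \<open>core k\<close>, one iterate inside it forces all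
  later ones inside, so convergence needs only one entry time for each \<open>k\<close>.\<close>

lemma Con_iff:
  assumes "f \<in> End_o G T"
  shows "x \<in> Con G T f \<longleftrightarrow> x \<in> carrier G \<and> (\<forall>k. \<exists>i. (f ^^ i) x \<in> core k)"
proof safe
  assume x: "x \<in> Con G T f"
  then show "x \<in> carrier G" by (simp add: Con_def)
  fix k
  have "eventually (\<lambda>n. (f ^^ n) x \<in> core k) sequentially"
    using x openin_core[of k] subgroup.one_closed[OF core_subgroup[of k]]
    by (auto simp: Con_def limitin_def)
  then show "\<exists>i. (f ^^ i) x \<in> core k" by (auto simp: eventually_sequentially)
next
  interpret f: filtered_group_endo G core f by (rule End_o_filtered_group_endo[OF assms])
  assume x: "x \<in> carrier G" "\<forall>k. \<exists>i. (f ^^ i) x \<in> core k"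
  have "eventually (\<lambda>n. (f ^^ n) x \<in> W) sequentially" if W: "openin T W" "\<one> \<in> W" for W
  proof -
    obtain k where k: "core k \<subseteq> W" using core_base[OF W] by blast
    obtain i where i: "(f ^^ i) x \<in> core k" using x(2) by blast
    have "(f ^^ n) x \<in> core k" if "i \<le> n" for n
    proof -
      interpret g: filtered_group_endo G core "f ^^ (n - i)" by (rule f.funpow_filtered_group_endo)
      have "(f ^^ (n - i)) ((f ^^ i) x) \<in> core k" using g.f_N[of k] i by auto
      then show ?thesis using that by (metis comp_apply funpow_add le_add_diff_inverse2)
    qed
    then show ?thesis using k unfolding eventually_sequentially by blast
  qed
  then show "x \<in> Con G T f" using x(1) by (simp add: Con_def limitin_def)
qed

text \<open>Translation makes the cosets \<open>x core k\<close> a base of neighbourhoods of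
  \<open>x\<close>.\<close>

lemma in_closure_iff:
  assumes "S \<subseteq> carrier G"
  shows "x \<in> T closure_of S \<longleftrightarrow> x \<in> carrier G \<and> (\<forall>k. \<exists>s \<in> S. s \<in> x <# core k)"
proof safe
  assume x: "x \<in> T closure_of S"
  then show xc: "x \<in> carrier G" by (simp add: in_closure_of)
  fix k
  have "x \<otimes> \<one> \<in> x <# core k"
    using subgroup.one_closed[OF core_subgroup[of k]] unfolding l_coset_def by blast
  then show "\<exists>s \<in> S. s \<in> x <# core k"
    using x xc openin_l_coset[OF xc openin_core[of k]] by (auto simp: in_closure_of)
next
  assume x: "x \<in> carrier G" "\<forall>k. \<exists>s \<in> S. s \<in> x <# core k"
  have "\<exists>s. s \<in> S \<and> s \<in> W" if W: "x \<in> W" "openin T W" for W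
  proof -
    have "inv x \<otimes> x \<in> inv x <# W" using W(1) unfolding l_coset_def by blast
    then obtain k where k: "core k \<subseteq> inv x <# W"
      using core_base[OF openin_l_coset[OF _ W(2)], of "inv x"] x(1) by auto
    obtain s n where s: "s \<in> S" "n \<in> core k" "s = x \<otimes> n" using x(2) unfolding l_coset_def by blast
    then obtain w where w: "w \<in> W" "n = inv x \<otimes> w" using k by (auto simp: l_coset_def)
    then have "s = w" using s(3) x(1) openin_subset_carrier[OF W(2)] by (auto simp: inv_cancel_left)
    then show ?thesis using s(1) w(1) by blast
  qed
  then show "x \<in> T closure_of S" using x(1) by (simp add: in_closure_of)
qed

lemma subgroup_closure_of:
  assumes S: "subgroup S G"
  shows "subgroup (T closure_of S) G"
proof (rule subgroupI)
  note cl = in_closure_iff[OF subgroup.subset[OF S]]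
  show "T closure_of S \<subseteq> carrier G" using closure_of_subset_topspace[of T S] by simp
  show "T closure_of S \<noteq> {}"
    using closure_of_subset[of S T] subgroup.subset[OF S] subgroup.one_closed[OF S] by auto
  note cD = invariant_subgroupsD[OF core_invariant]
  fix x assume x: "x \<in> T closure_of S"
  then have xc: "x \<in> carrier G" using cl by blast
  have "\<exists>s \<in> S. s \<in> inv x <# core k" for k
  proof -
    obtain n where n: "x \<otimes> n \<in> S" "n \<in> core k" using x cl[of x] by (auto simp: l_coset_def)
    have nc: "n \<in> carrier G" using n(2) core_subset by auto
    have "inv (x \<otimes> n) = inv x \<otimes> (x \<otimes> inv n \<otimes> inv x)"
      using xc nc by (simp add: inv_mult_group m_assoc inv_cancel_left)
    moreover have "x \<otimes> inv n \<otimes> inv x \<in> core k" using cD(6,7) n(2) xc by blast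
    ultimately show ?thesis using subgroup.m_inv_closed[OF S n(1)] unfolding l_coset_def by blast
  qed
  then show "inv x \<in> T closure_of S" using cl xc by blast
  fix y assume y: "y \<in> T closure_of S"
  then have yc: "y \<in> carrier G" using cl by blast
  have "\<exists>s \<in> S. s \<in> (x \<otimes> y) <# core k" for k
  proof -
    obtain n where n: "x \<otimes> n \<in> S" "n \<in> core k" using x cl[of x] by (auto simp: l_coset_def)
    obtain m where m: "y \<otimes> m \<in> S" "m \<in> core k" using y cl[of y] by (auto simp: l_coset_def)
    have c: "n \<in> carrier G" "m \<in> carrier G" using n(2) m(2) core_subset by auto
    \<comment> \<open>Normality of the core moves the error \<open>n\<close> past \<open>y\<close>,
      leaving both errors on the right.\<close>
    have "(x \<otimes> n) \<otimes> (y \<otimes> m) = (x \<otimes> y) \<otimes> ((inv y \<otimes> n \<otimes> y) \<otimes> m)"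
      using xc yc c by (simp add: m_assoc inv_cancel_left)
    moreover have "(inv y \<otimes> n \<otimes> y) \<otimes> m \<in> core k"
      using cD(5) invariant_conj_inv[OF subgroup_self core_invariant yc n(2)] m(2) by blast
    ultimately show ?thesis using subgroup.m_closed[OF S n(1) m(1)] unfolding l_coset_def by blast
  qed
  then show "x \<otimes> y \<in> T closure_of S" using cl xc yc by blast
qed

section \<open>The closed subgroup centralising all chief factors\<close>

text \<open>The condition \<open>core n \<subseteq> B\<close> selects factors with open
  \<open>B\<close>, whose centralisers are open; their intersection is therefore closed.\<close>

definition chief_centraliser :: "'a set" where
  "chief_centraliser = {x \<in> carrier G. \<forall>A B n. chief_factor G (carrier G) A B \<and> core n \<subseteq> B \<longrightarrow>
     centralises G x A B}"

lemma chief_centraliser_eq: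
  "chief_centraliser = \<Inter>(insert (carrier G)
     ((\<lambda>(A, B). {x \<in> carrier G. centralises G x A B}) `
      {(A, B). chief_factor G (carrier G) A B \<and> (\<exists>n. core n \<subseteq> B)}))"
  by (auto simp: chief_centraliser_def)

lemma open_centraliser:
  assumes "chief_factor G (carrier G) A B" "core n \<subseteq> B"
  shows "subgroup {x \<in> carrier G. centralises G x A B} G"
    and "openin T {x \<in> carrier G. centralises G x A B}"
proof -
  have inv: "A \<in> invariant_subgroups G (carrier G)" "B \<in> invariant_subgroups G (carrier G)" "B \<subset> A"
    using assms(1) by (auto simp: chief_factor_def)
  show sub: "subgroup {x \<in> carrier G. centralises G x A B} G"
    by (rule centralises_subgroup[OF subgroup_self inv(2) invariant_subgroupsD(3)[OF inv(1)]])
  obtain k where "covered_by_cosets G (carrier G) (core n) k"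
    using covered_by_cosets_finite_index[OF N_invariant N_finite_index] by blast
  then have "covered_by_cosets G A B k"
    by (rule covered_by_cosets_mono[OF _ invariant_subgroupsD(3)[OF inv(1)] assms(2)])
  then have "core k \<subseteq> {x \<in> carrier G. centralises G x A B}"
    using centralises_covered_by_cosets[OF inv(1,2) assms(2)] core_subset by auto
  then show "openin T {x \<in> carrier G. centralises G x A B}"
    by (rule openin_subgroup[OF sub openin_core subgroup.one_closed[OF core_subgroup]])
qed

lemma chief_centraliser_closed_subgroup:
  "subgroup chief_centraliser G" "closedin T chief_centraliser"
proof -
  show "subgroup chief_centraliser G"
    unfolding chief_centraliser_eq using open_centraliser(1) subgroup_self
    by (intro subgroups_Inter) auto
  show "closedin T chief_centraliser"
    unfolding chief_centraliser_eq
    using closedin_open_subgroup[OF open_centraliser] closedin_topspace[of T]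
    by (intro closedin_Inter) auto
qed

lemma Con_subset_chief_centraliser:
  assumes "f \<in> End_o G T"
  shows "Con G T f \<subseteq> chief_centraliser"
proof
  interpret f: filtered_group_endo G core f by (rule End_o_filtered_group_endo[OF assms])
  fix x assume "x \<in> Con G T f"
  then have "x \<in> carrier G" "\<And>k. \<exists>i. (f ^^ i) x \<in> core k" using Con_iff[OF assms] by auto
  then show "x \<in> chief_centraliser"
    using f.contracted_centralises_chief_factor by (auto simp: chief_centraliser_def)
qed

text \<open>An open normal subgroup of \<open>K\<close> contains some
  \<open>K \<inter> core n\<close>, and a term of the lower central series of \<open>K\<close> lies
  inside this intersection.\<close>

lemma pronilpotent_closed_subgroup:
  assumes K: "subgroup K G" "closedin T K" "K \<subseteq> chief_centraliser"
  shows "pronilpotent_group (G\<lparr>carrier := K\<rparr>) (subtopology T K)"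
  unfolding pronilpotent_group_def
proof (intro conjI allI impI)
  show "profinite_group (G\<lparr>carrier := K\<rparr>) (subtopology T K)"
    by (rule profinite_group_closed_subgroup[OF profinite K(1,2)])
  fix P assume P: "P \<lhd> G\<lparr>carrier := K\<rparr> \<and> openin (subtopology T K) P"
  then obtain W where W: "openin T W" "P = W \<inter> K" by (auto simp: openin_subtopology)
  interpret P: normal P "G\<lparr>carrier := K\<rparr>" using P by simp
  have "\<one>\<^bsub>G\<lparr>carrier := K\<rparr>\<^esub> \<in> P" using P.subgroup_axioms by (rule subgroup.one_closed)
  then have "\<one> \<in> W" using W(2) by simp
  then obtain n where "core n \<subseteq> W" using core_base[OF W(1)] by blast
  moreover have "centralises G x A B"
    if "x \<in> K" "chief_factor G (carrier G) A B" "core m \<subseteq> B" for x A B m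
    using that K(3) unfolding chief_centraliser_def by blast
  then obtain r where "lower_central_series (G\<lparr>carrier := K\<rparr>) r \<subseteq> core n"
    using lower_central_series_le[OF K(1), of n] by blast
  moreover have "lower_central_series (G\<lparr>carrier := K\<rparr>) r \<subseteq> K"
    using lower_central_series_subset[OF P.is_group, of r] by simp
  ultimately have "lower_central_series (G\<lparr>carrier := K\<rparr>) r \<subseteq> P" using W(2) by blast
  then show "nilpotent_group (G\<lparr>carrier := K\<rparr> Mod P)" by (rule P.nilpotent_FactGroup)
qed

lemma Con_subset: "Con G T f \<subseteq> carrier G"
  by (auto simp: Con_def)

lemma O_subgroup_properties:
  shows "subgroup (O_subgroup G T \<Lambda>) G" "closedin T (O_subgroup G T \<Lambda>)"
  unfolding O_subgroup_def using Con_subset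
  by (auto intro!: subgroup_closure_of generate_is_subgroup)

lemma O_subgroup_subset_chief_centraliser:
  assumes "\<Lambda> \<subseteq> End_o G T"
  shows "O_subgroup G T \<Lambda> \<subseteq> chief_centraliser"
  unfolding O_subgroup_def using assms Con_subset_chief_centraliser
  by (intro closure_of_minimal generate_subgroup_incl chief_centraliser_closed_subgroup) auto

section \<open>Generation by contracted elements\<close>

text \<open>The sets \<open>P i\<close> of coset elements eventually sent into \<open>core i\<close>
  are closed, nonempty and decreasing. By compactness they share an element, which is
  contracted.\<close>

lemma Con_meets_coset:
  assumes f: "f \<in> End_o G T" and sub: "f ` carrier G \<subseteq> core j" and g: "g \<in> carrier G"
  shows "\<exists>c \<in> Con G T f. c \<in> g <# core j"
proof -
  interpret f: filtered_group_endo G core f by (rule End_o_filtered_group_endo[OF f])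
  note cD = invariant_subgroupsD[OF core_invariant]
  have iter_closed: "(f ^^ n) x \<in> carrier G" if "x \<in> carrier G" for n x
    using filtered_group_endo.f_closed[OF f.funpow_filtered_group_endo that] .
  define P where "P i = {c \<in> g <# core j. \<exists>n. (f ^^ n) c \<in> core i}" for i
  have gj: "g <# core j \<subseteq> carrier G" using g core_subset[of j] by (auto simp: l_coset_def)
  have "P i \<noteq> {}" for i
  proof -
    \<comment> \<open>These images of \<open>f^n\<close> modulo \<open>core i\<close> form a
      descending family of subgroups above \<open>core i\<close>, of which there are finitely many,
      so they stabilise.\<close>
    define L where "L n = (f ^^ n) ` carrier G <#> core i" for n
    have dec: "(f ^^ n) ` carrier G \<subseteq> (f ^^ m) ` carrier G" if "m \<le> n" for m n
    proof -
      have "(f ^^ n) x = (f ^^ m) ((f ^^ (n - m)) x)" for x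
        using that by (metis comp_apply funpow_add le_add_diff_inverse)
      then show ?thesis using iter_closed by auto
    qed
    have Lsub: "subgroup (L n) G" "core i \<subseteq> L n" for n
    proof -
      interpret h: filtered_group_endo G core "f ^^ n" by (rule f.funpow_filtered_group_endo)
      interpret hh: group_hom G G "f ^^ n" using h.f_hom by unfold_locales
      let ?H = "(f ^^ n) ` carrier G"
      have H: "subgroup ?H G" by (rule hh.img_is_subgroup)
      show "subgroup (L n) G"
        unfolding L_def
        by (rule subgroup_set_mult[OF subgroup_self H subgroup.subset[OF H] core_invariant])
      show "core i \<subseteq> L n" unfolding L_def by (rule set_mult_upper(2)[OF H core_subgroup])
    qed
    have "finite {X. subgroup X G \<and> core i \<subseteq> X}"
      using N_finite_overgroups[OF order_refl] by (simp add: finite_overgroups_def)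
    then have "finite (range L)" using Lsub by (elim finite_subset[rotated]) auto
    then obtain X where X: "X \<in> range L" "\<And>Y. Y \<in> range L \<Longrightarrow> Y \<subseteq> X \<Longrightarrow> Y = X"
      using finite_has_minimal[of "range L"] by (metis UNIV_I empty_iff image_eqI)
    then obtain m where m: "X = L m" by blast
    have stable: "L n = X" if "m \<le> n" for n
      using X(2) m mono_set_mult[OF dec[OF that] order_refl, of G "core i"] by (simp add: L_def)
    \<comment> \<open>The successor ensures \<open>n \<ge> 1\<close>, so that
      \<open>u = f^n(h)\<close> lies in \<open>f(G)\<close> and hence in
      \<open>core j\<close>.\<close>
    define n where "n = Suc m"
    have "L n = L (n + n)" using stable by (simp add: n_def)
    moreover have fg: "(f ^^ n) g \<in> carrier G" using iter_closed[OF g] .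
    then have "(f ^^ n) g \<otimes> \<one> \<in> L n"
      unfolding L_def using g subgroup.one_closed[OF core_subgroup[of i]] by (intro set_multI) auto
    ultimately have "(f ^^ n) g \<in> L (n + n)" using fg by simp
    then obtain h t where h: "h \<in> carrier G" "t \<in> core i" "(f ^^ n) g = (f ^^ (n + n)) h \<otimes> t"
      by (auto simp: L_def set_mult_def)
    define u where "u = (f ^^ n) h"
    have u: "u \<in> carrier G" "u \<in> core j"
      using sub f.f_closed iter_closed[OF h(1), of m] by (auto simp: u_def n_def)
    interpret p: filtered_group_endo G core "f ^^ n" by (rule f.funpow_filtered_group_endo)
    interpret ph: group_hom G G "f ^^ n" using p.f_hom by unfold_locales
    have fu: "(f ^^ n) u \<in> carrier G" using iter_closed[OF u(1)] .
    have tc: "t \<in> carrier G" using h(2) core_subset by auto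
    \<comment> \<open>Since \<open>f^n(g) = f^n(u) t\<close>, cancelling \<open>u\<close> leaves a
      conjugate of \<open>t\<close>, which stays in the normal subgroup
      \<open>core i\<close>.\<close>
    have "(f ^^ n) (g \<otimes> inv u) = (f ^^ n) u \<otimes> t \<otimes> inv ((f ^^ n) u)"
      using g u(1) h(3) by (simp add: u_def funpow_add)
    then have "(f ^^ n) (g \<otimes> inv u) \<in> core i" using cD(7)[OF fu h(2)] by simp
    moreover have "g \<otimes> inv u \<in> g <# core j" using cD(6)[OF u(2)] by (auto simp: l_coset_def)
    ultimately show ?thesis unfolding P_def by blast
  qed
  moreover have "decseq P"
    unfolding P_def decseq_def using core_antimono by blast
  moreover have "closedin T (P i)" for i
  proof -
    \<comment> \<open>This subgroup contains \<open>core i\<close>, so it is open and therefore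
      closed, although it is a union over all iterates.\<close>
    let ?Z = "{c \<in> carrier G. \<exists>n. (f ^^ n) c \<in> core i}"
    have "core j \<lhd> G"
      using core_invariant[of j] by (simp add: invariant_subgroups_def normal_inv_iff)
    then have "core j #> g = g <# core j" using normal.coset_eq g by blast
    moreover have "closedin T (core j #> g)"
      using closedin_union_cosets[OF core_subgroup openin_core, of "{core j #> g}" j]
        rcosetsI[OF core_subset g, of j] by simp
    ultimately have "closedin T (g <# core j)" by simp
    moreover have "subgroup ?Z G"
    proof (rule subgroupI)
      have "(f ^^ 0) \<one> \<in> core i" using subgroup.one_closed[OF core_subgroup] by simp
      then show "?Z \<noteq> {}" by blast
      fix x assume "x \<in> ?Z"
      then obtain n where x: "x \<in> carrier G" "(f ^^ n) x \<in> core i" by blast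
      interpret n: filtered_group_endo G core "f ^^ n" by (rule f.funpow_filtered_group_endo)
      interpret nh: group_hom G G "f ^^ n" using n.f_hom by unfold_locales
      have "(f ^^ n) (inv x) \<in> core i" using x cD(6) by simp
      then show "inv x \<in> ?Z" using x(1) by blast
      fix y assume "y \<in> ?Z"
      then obtain m where y: "y \<in> carrier G" "(f ^^ m) y \<in> core i" by blast
      interpret m: filtered_group_endo G core "f ^^ m" by (rule f.funpow_filtered_group_endo)
      interpret mh: group_hom G G "f ^^ m" using m.f_hom by unfold_locales
      \<comment> \<open>The exponent \<open>n + m\<close> brings both elements into
        \<open>core i\<close>, since iterates preserve it.\<close>
      have "(f ^^ (n + m)) x = (f ^^ m) ((f ^^ n) x)" by (metis add.commute comp_apply funpow_add)
      then have "(f ^^ (n + m)) x \<in> core i" using x(2) m.f_N[of i] by auto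
      moreover have "(f ^^ (n + m)) y \<in> core i" using y(2) n.f_N[of i] by (auto simp: funpow_add)
      ultimately have "(f ^^ (n + m)) x \<otimes> (f ^^ (n + m)) y \<in> core i" by (rule cD(5))
      moreover have "(f ^^ (n + m)) (x \<otimes> y) = (f ^^ (n + m)) x \<otimes> (f ^^ (n + m)) y"
        using x(1) y(1) m.f_closed by (simp add: funpow_add)
      ultimately show "x \<otimes> y \<in> ?Z" using x(1) y(1) by (metis (mono_tags, lifting) m_closed mem_Collect_eq)
    qed auto
    moreover have "core i \<subseteq> ?Z"
    proof
      fix x assume "x \<in> core i"
      then have "x \<in> carrier G" "(f ^^ 0) x \<in> core i" using core_subset by auto
      then show "x \<in> ?Z" by blast
    qed
    ultimately have "closedin T (g <# core j)" "closedin T ?Z"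
      using closedin_open_subgroup[of ?Z] openin_subgroup[of ?Z "core i"] openin_core
        subgroup.one_closed[OF core_subgroup] by auto
    then have "closedin T ((g <# core j) \<inter> ?Z)" by (rule closedin_Int)
    moreover have "P i = (g <# core j) \<inter> ?Z" using gj by (auto simp: P_def)
    ultimately show ?thesis by simp
  qed
  ultimately have "(\<Inter>i. P i) \<noteq> {}" using compact_space_imp_nest[OF compact_T] by blast
  then obtain c where c: "\<And>i. c \<in> P i" by blast
  then have "c \<in> g <# core j" "\<And>i. \<exists>n. (f ^^ n) c \<in> core i" by (auto simp: P_def)
  then show ?thesis using Con_iff[OF f] gj by blast
qed

text \<open>Density: for each \<open>k\<close> some \<open>f\<close> in the family has image inside
  \<open>core k\<close>, and its contracted elements meet every coset of
  \<open>core k\<close>.\<close>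

lemma O_subgroup_eq_carrier:
  assumes \<Lambda>: "\<Lambda> \<subseteq> End_o G T"
    and base: "neighbourhood_base_at \<one> (\<lambda>V. V \<in> {f ` carrier G | f. f \<in> \<Lambda>}) T"
  shows "O_subgroup G T \<Lambda> = carrier G"
proof
  show "O_subgroup G T \<Lambda> \<subseteq> carrier G"
    using O_subgroup_properties(1) by (rule subgroup.subset)
  show "carrier G \<subseteq> O_subgroup G T \<Lambda>"
  proof
    fix g assume g: "g \<in> carrier G"
    let ?S = "generate G (\<Union>f \<in> \<Lambda>. Con G T f)"
    have S: "?S \<subseteq> carrier G" using Con_subset by (intro generate_incl) auto
    have "\<exists>s \<in> ?S. s \<in> g <# core k" for k
    proof -
      obtain f where f: "f \<in> \<Lambda>" "f ` carrier G \<subseteq> core k"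
        using base openin_core[of k] subgroup.one_closed[OF core_subgroup[of k]]
        unfolding neighbourhood_base_at_def by (auto; metis)
      then obtain c where "c \<in> Con G T f" "c \<in> g <# core k"
        using Con_meets_coset[OF _ f(2) g] \<Lambda> by blast
      then show ?thesis using f(1) by (blast intro: generate.incl)
    qed
    then show "g \<in> O_subgroup G T \<Lambda>"
      unfolding O_subgroup_def in_closure_iff[OF S] using g by blast
  qed
qed

end



theorem theoremB:
  fixes G :: "('a, 'b) monoid_scheme"
    and T :: "'a topology"
    and \<Lambda> :: "('a \<Rightarrow> 'a) set"
  assumes "profinite_group G T"
    and "type_F G T"
    and "\<Lambda> \<subseteq> End_o G T"
  shows "pronilpotent_group (G\<lparr>carrier := O_subgroup G T \<Lambda>\<rparr>) (subtopology T (O_subgroup G T \<Lambda>))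
       \<and> (neighbourhood_base_at \<one>\<^bsub>G\<^esub> (\<lambda>V. V \<in> {f ` carrier G | f. f \<in> \<Lambda>}) T \<longrightarrow>
            carrier G = O_subgroup G T \<Lambda> \<and> pronilpotent_group G T)"
proof -
  interpret group G using assms(1) by (simp add: profinite_group_def topological_group_def)
  interpret profinite_type_F G T using assms(1,2) by unfold_locales
  have O: "pronilpotent_group (G\<lparr>carrier := O_subgroup G T \<Lambda>\<rparr>) (subtopology T (O_subgroup G T \<Lambda>))"
    by (rule pronilpotent_closed_subgroup[OF O_subgroup_properties
          O_subgroup_subset_chief_centraliser[OF assms(3)]])
  \<comment> \<open>For the second part, equality with the carrier turns the restricted group and
    the subspace topology back into \<open>G\<close> and \<open>T\<close>.\<close>
  then show ?thesis
    using O_subgroup_eq_carrier[OF assms(3)] subtopology_topspace[of T] by auto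
qed

end
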